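(* Consider the following setting: - A linear operator $\mathrm{L}_1^*$ that is injective on $C_0(\mathbb{R}^d)$ and the corresponding dual pair of Banach spaces $\mathcal{B}_1=\mathrm{L}_1^*\big(C_0(\mathbb{R}^d)\big)$ and $\mathcal{B}_1'=\mathrm{L}_1^{-1}\big(\mathcal{M}(\mathbb{R}^d)\big)$. - A linear operator $\mathrm{L}_2^*$ that is injective on $L_2(\mathbb{R}^d)$ and the corresponding dual pair of Hilbert spaces $\mathcal{H}_2=\mathrm{L}_2^*\big(L_2(\mathbb{R}^d)\big)$ and $\mathcal{H}_2'=\mathrm{L}_2^{-1}\big(L_2(\mathbb{R}^d)\big)$. - The linear measurement operator $\boldsymbol{\nu}=(\nu_1,\dots,\nu_M):\mathcal{B}_1'+\mathcal{H}_2'\to\mathbb{R}^M$ with $\nu_1,\dots,\nu_M\in\mathcal{B}_1\cap\mathcal{H}_2$. - A strictly convex loss functional $E:\mathbb{R}^M\times\mathbb{R}^M\to\mathbb{R}^+$. - Two adjustable weights $\lambda_1,\lambda_2>0$. Then, for any given $\boldsymbol{y}\in\mathbb{R}^M$, the two-component regularized inverse problem $$S=\arg\min_{f=f_1+f_2:\ (f_1,f_2)\in\mathcal{B}_1'\times\mathcal{H}_2'}\Big(E\big(\boldsymbol{y},\boldsymbol{\nu}(f)\big)+\lambda_1\|\mathrm{L}_1f_1\|_{\mathcal{M}}^2+\lambda_2\|\mathrm{L}_2f_2\|_{L_2}^2\Big)$$ has a nonempty (and weak*-compact) solution set $S$. Any solution can be written as $f_0=f_{0,1}+f_{0,2}$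 with $f_{0,1}\in S|_{\mathcal{B}_1'}$ and a unique $$f_{0,2}=\sum_{m=1}^M\widetilde{a}_m\varphi_m,$$ with $\varphi_m=\mathrm{L}_2^{-1}\mathrm{L}_2^{-1*}\{\nu_m\}$ and $(\widetilde{a}_m)\in\mathbb{R}^M$, that is common to all solutions. Moreover, the extremal points of $S|_{\mathcal{B}_1'}$ can all be expressed as $$f_{0,1}=\sum_{k=1}^{K_1}c_kh_1(\cdot,\boldsymbol{\tau}_k)$$ with $K_1\le M$, $(c_k)\in\mathbb{R}^{K_1}$, and $h_1(\cdot,\boldsymbol{\tau}_k)=\mathrm{L}_1^{-1}\{\delta(\cdot-\boldsymbol{\tau}_k)\}$, where $\boldsymbol{\tau}_1,\dots,\boldsymbol{\tau}_{K_1}\in\mathbb{R}^d$ are adaptive centers.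
   Context: $C_0(\mathbb{R}^d)$ is the Banach space of real continuous functions vanishing at infinity (sup norm), and $\mathcal{M}(\mathbb{R}^d)=(C_0(\mathbb{R}^d))'$ is the space of (finite) Radon measures with the total-variation norm $\|\cdot\|_{\mathcal{M}}$; $\delta(\cdot-\boldsymbol{\tau})$ is the Dirac measure at $\boldsymbol{\tau}$. If $\mathrm{L}^*$ is a linear operator that is injective on a Banach space $\mathcal{X}$, then $\mathcal{B}=\mathrm{L}^*(\mathcal{X})$ is a Banach space with norm $\|\mathrm{L}^{*-1}\{\cdot\}\|_{\mathcal{X}}$, so that $\mathrm{L}^*:\mathcal{X}\to\mathcal{B}$ is an isometric isomorphism, with inverse $\mathrm{L}^{-1*}=\mathrm{L}^{*-1}:\mathcal{B}\to\mathcal{X}$. Its adjoint $\mathrm{L}:\mathcal{B}'\to\mathcal{X}'$ is an isometric isomorphism with inverse $\mathrm{L}^{-1}:\mathcal{X}'\to\mathcal{B}'$, so $\mathcal{B}'=\mathrm{L}^{-1}(\mathcal{X}')$ with norm $\|f\|_{\mathcal{B}'}=\|\mathrm{L}f\|_{\mathcal{X}'}$. Here this is used with $\mathcal{X}=C_0(\mathbb{R}^d)$, $\mathrm{L}=\mathrm{L}_1$ and with $\mathcal{X}=L_2(\mathbb{R}^d)$ (identified with its own dual), $\mathrm{L}=\mathrm{L}_2$; in the second case $\mathrm{L}_2^{-1}\mathrm{L}_2^{-1*}:\mathcal{H}_2\to\mathcal{H}_2'$ is the Riesz map. The spaces consist of (generalized) functions over the same domain $\mathbb{R}^d$, so that $\mathcal{B}_1'+\mathcal{H}_2'$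 and $\mathcal{B}_1\cap\mathcal{H}_2$ make sense, and $\nu_m(f_1+f_2)=\langle\nu_m,f_1\rangle_{\mathcal{B}_1\times\mathcal{B}_1'}+\langle\nu_m,f_2\rangle_{\mathcal{H}_2\times\mathcal{H}_2'}$. The problem is an optimization over pairs $(f_1,f_2)\in\mathcal{B}_1'\times\mathcal{H}_2'$, and $S$ is the set of minimizing pairs; $S|_{\mathcal{B}_1'}$ denotes the set of first components of elements of $S$. Strict convexity of $E$ is understood in its second argument. An extremal point of a convex set $C$ is $f\in C$ such that $f=tf_1+(1-t)f_2$ with $f_1,f_2\in C$, $t\in(0,1)$ implies $f=f_1=f_2$. *)

theory Defs
  imports "HOL-Analysis.Analysis"
begin

section \<open>The Banach space of continuous functions vanishing at infinity\<close>

text \<open>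
  The type of bounded continuous functions already carries the supremum norm.  Functions
  vanishing at infinity are automatically bounded (lemma \<open>c0_cases\<close>), so nothing is lost by
  cutting the new type out of that one.
\<close>

typedef (overloaded) 'a c0 =
  "{f :: 'a::euclidean_space \<Rightarrow>\<^sub>C real. (apply_bcontfun f \<longlongrightarrow> 0) at_infinity}"
  morphisms bcontfun_of_c0 Abs_c0
  by (rule exI[of _ 0]) simp

setup_lifting type_definition_c0

lift_definition apply_c0 :: "'a::euclidean_space c0 \<Rightarrow> 'a \<Rightarrow> real" is apply_bcontfun .

instantiation c0 :: (euclidean_space) real_vector
begin

lift_definition zero_c0 :: "'a c0" is 0 by simp
lift_definition plus_c0 :: "'a c0 \<Rightarrow> 'a c0 \<Rightarrow> 'a c0" is "(+)"
  by (simp add: tendsto_add_zero)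
lift_definition minus_c0 :: "'a c0 \<Rightarrow> 'a c0 \<Rightarrow> 'a c0" is "(-)"
  using tendsto_diff[of _ 0 at_infinity _ 0] by simp
lift_definition uminus_c0 :: "'a c0 \<Rightarrow> 'a c0" is uminus
  using tendsto_minus[of _ 0 at_infinity] by simp
lift_definition scaleR_c0 :: "real \<Rightarrow> 'a c0 \<Rightarrow> 'a c0" is scaleR
  by (simp add: tendsto_mult_right_zero)

instance
  by standard (transfer, simp add: scaleR_add_right scaleR_add_left)+

end

instantiation c0 :: (euclidean_space) real_normed_vector
begin

lift_definition norm_c0 :: "'a c0 \<Rightarrow> real" is norm .
definition sgn_c0 :: "'a c0 \<Rightarrow> 'a c0" where "sgn_c0 f = f /\<^sub>R norm f"
definition dist_c0 :: "'a c0 \<Rightarrow> 'a c0 \<Rightarrow> real" where "dist_c0 f g = norm (f - g)"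
definition uniformity_c0 :: "('a c0 \<times> 'a c0) filter"
  where "uniformity_c0 = (INF e\<in>{0 <..}. principal {(x, y). dist x y < e})"
definition open_c0 :: "'a c0 set \<Rightarrow> bool"
  where "open_c0 S = (\<forall>x\<in>S. \<forall>\<^sub>F (x', y) in uniformity. x' = x \<longrightarrow> y \<in> S)"

instance
proof
  fix a :: real and f g :: "'a c0"
  show "norm f = 0 \<longleftrightarrow> f = 0" by transfer simp
  show "norm (f + g) \<le> norm f + norm g" by transfer (rule norm_triangle_ineq)
  show "norm (a *\<^sub>R f) = \<bar>a\<bar> * norm f" by transfer simp
qed (rule sgn_c0_def dist_c0_def uniformity_c0_def open_c0_def)+

end

lemma apply_c0_simps [simp]:
  "apply_c0 0 x = 0"
  "apply_c0 (f + g) x = apply_c0 f x + apply_c0 g x"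
  "apply_c0 (f - g) x = apply_c0 f x - apply_c0 g x"
  "apply_c0 (- f) x = - apply_c0 f x"
  "apply_c0 (a *\<^sub>R f) x = a * apply_c0 f x"
  by (transfer, simp)+

lemma c0_eqI: "(\<And>x. apply_c0 f x = apply_c0 g x) \<Longrightarrow> f = g"
  by transfer (rule bcontfun_eqI)

lemma continuous_on_apply_c0: "continuous_on A (apply_c0 f)"
  by transfer simp

lemma apply_c0_tendsto_0: "(apply_c0 f \<longlongrightarrow> 0) at_infinity"
  by transfer simp

lemma norm_c0_eq_SUP: "norm f = (SUP x. \<bar>apply_c0 f x\<bar>)"
  by transfer (simp add: norm_bcontfun_def dist_bcontfun.rep_eq)

lemma abs_apply_c0_le: "\<bar>apply_c0 f x\<bar> \<le> norm f"
  by transfer (metis norm_bounded real_norm_def)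

lemma c0_cases:
  fixes f :: "'a::euclidean_space \<Rightarrow> real"
  assumes "continuous_on UNIV f" and "(f \<longlongrightarrow> 0) at_infinity"
  obtains g where "f = apply_c0 g"
proof -
  have "\<forall>\<^sub>F x in at_infinity. \<bar>f x\<bar> < 1"
    using tendstoD[OF assms(2), of 1] by (simp add: dist_real_def)
  then obtain b where b: "\<And>x. b \<le> norm x \<Longrightarrow> \<bar>f x\<bar> < 1"
    by (auto simp: eventually_at_infinity)
  have "compact (f ` cball 0 b)"
    using assms(1) continuous_on_subset by (intro compact_continuous_image) auto
  then have "bounded (f ` cball 0 b)" by (rule compact_imp_bounded)
  then obtain c where "\<forall>t \<in> f ` cball 0 b. norm t \<le> c" unfolding bounded_iff ..
  then have c: "\<bar>f x\<bar> \<le> c" if "norm x \<le> b" for x using that by simp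
  have "\<bar>f x\<bar> \<le> max 1 c" for x
    using b[of x] c[of x] by linarith
  then have f: "f \<in> bcontfun"
    by (intro bcontfun_normI assms(1)) (simp add: real_norm_def)
  have "f = apply_c0 (Abs_c0 (Bcontfun f))"
    by (simp add: apply_c0.rep_eq Abs_c0_inverse Bcontfun_inverse[OF f] assms(2))
  then show thesis by (rule that)
qed

instance c0 :: (euclidean_space) banach
proof
  fix X :: "nat \<Rightarrow> 'a c0"
  assume "Cauchy X"
  then have "Cauchy (\<lambda>n. bcontfun_of_c0 (X n))"
    by (simp add: Cauchy_def dist_norm norm_c0.rep_eq minus_c0.rep_eq)
  then obtain l where l: "(\<lambda>n. bcontfun_of_c0 (X n)) \<longlonglongrightarrow> l"
    using Cauchy_convergent convergent_def by blast
  have u: "uniform_limit UNIV (\<lambda>n. apply_c0 (X n)) (apply_bcontfun l) sequentially"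
    using tendsto_bcontfun_uniform_limit[OF l] by (simp add: apply_c0.rep_eq)
  have "(apply_bcontfun l \<longlongrightarrow> 0) at_infinity"
  proof (rule tendstoI)
    fix e :: real assume e: "0 < e"
    obtain n where n: "\<And>x. dist (apply_c0 (X n) x) (apply_bcontfun l x) < e / 2"
      using uniform_limitD[OF u, of "e/2"] e
      by (auto dest!: eventually_happens)
    have "\<forall>\<^sub>F x in at_infinity. dist (apply_c0 (X n) x) 0 < e / 2"
      using tendstoD[OF apply_c0_tendsto_0, of "e/2"] e by simp
    then show "\<forall>\<^sub>F x in at_infinity. dist (apply_bcontfun l x) 0 < e"
    proof eventually_elim
      case (elim x)
      then show ?case using n[of x] unfolding dist_real_def by linarith
    qed
  qed
  then have "bcontfun_of_c0 (Abs_c0 l) = l"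
    by (simp add: Abs_c0_inverse)
  then have "X \<longlonglongrightarrow> Abs_c0 l"
    using l by (simp add: LIMSEQ_iff norm_c0.rep_eq minus_c0.rep_eq)
  then show "convergent X" by (auto simp: convergent_def)
qed

text \<open>
  The Radon measures are the continuous dual of \<open>c0\<close>; the operator norm of the dual is the
  total-variation norm.
\<close>

type_synonym 'a radon = "'a c0 \<Rightarrow>\<^sub>L real"

lift_definition dirac :: "'a::euclidean_space \<Rightarrow> 'a radon" is "\<lambda>\<tau> f. apply_c0 f \<tau>"
  by (rule bounded_linear_intro[where K = 1]) (simp_all add: abs_apply_c0_le)


section \<open>The Hilbert space of square-integrable functions\<close>

definition square_integrable :: "('a::euclidean_space \<Rightarrow> real) \<Rightarrow> bool" where
  "square_integrable f \<longleftrightarrow> f \<in> borel_measurable lborel \<and> integrable lborel (\<lambda>x. (f x)\<^sup>2)"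

definition l2_rel :: "('a::euclidean_space \<Rightarrow> real) \<Rightarrow> ('a \<Rightarrow> real) \<Rightarrow> bool" where
  "l2_rel f g \<longleftrightarrow> square_integrable f \<and> square_integrable g \<and> (AE x in lborel. f x = g x)"

lemma square_integrable_zero: "square_integrable (\<lambda>_. 0)"
  by (simp add: square_integrable_def)

lemma square_integrable_mult:
  assumes "square_integrable f" "square_integrable g"
  shows "integrable lborel (\<lambda>x. f x * g x)"
proof (rule Bochner_Integration.integrable_bound)
  show "integrable lborel (\<lambda>x. (f x)\<^sup>2 + (g x)\<^sup>2)"
    using assms by (simp add: square_integrable_def)
  show "(\<lambda>x. f x * g x) \<in> borel_measurable lborel"
    using assms unfolding square_integrable_def by (intro borel_measurable_times) auto
  have "\<bar>a * b\<bar> \<le> a\<^sup>2 + b\<^sup>2" for a b :: real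
    using sum_squares_bound[of "\<bar>a\<bar>" "\<bar>b\<bar>"] zero_le_mult_iff[of "\<bar>a\<bar>" "\<bar>b\<bar>"]
    unfolding abs_mult power2_abs by linarith
  then show "AE x in lborel. norm (f x * g x) \<le> norm ((f x)\<^sup>2 + (g x)\<^sup>2)"
    by (intro AE_I2) simp
qed

lemma square_integrable_add:
  assumes "square_integrable f" "square_integrable g"
  shows "square_integrable (\<lambda>x. f x + g x)"
  using assms square_integrable_mult[OF assms]
  by (auto simp: square_integrable_def power2_sum mult.assoc)

lemma square_integrable_scale:
  "square_integrable f \<Longrightarrow> square_integrable (\<lambda>x. a * f x)"
  by (auto simp: square_integrable_def power_mult_distrib)

lemma square_integrable_uminus:
  "square_integrable f \<Longrightarrow> square_integrable (\<lambda>x. - f x)"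
  by (auto simp: square_integrable_def)

lemma square_integrable_diff:
  "square_integrable f \<Longrightarrow> square_integrable g \<Longrightarrow> square_integrable (\<lambda>x. f x - g x)"
  using square_integrable_add[of f "\<lambda>x. - g x"] square_integrable_uminus[of g] by simp

quotient_type (overloaded) 'a l2 = "'a::euclidean_space \<Rightarrow> real" / partial: l2_rel
proof (rule part_equivpI)
  show "\<exists>f :: 'a \<Rightarrow> real. l2_rel f f"
    by (rule exI[of _ "\<lambda>_. 0"]) (simp add: l2_rel_def square_integrable_zero)
  show "symp (l2_rel :: ('a \<Rightarrow> real) \<Rightarrow> _)"
    by (auto simp: symp_def l2_rel_def)
  show "transp (l2_rel :: ('a \<Rightarrow> real) \<Rightarrow> _)"
  proof (rule transpI)
    fix f g h :: "'a \<Rightarrow> real"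
    assume "l2_rel f g" "l2_rel g h"
    moreover from this have "AE x in lborel. f x = g x" "AE x in lborel. g x = h x"
      by (simp_all add: l2_rel_def)
    then have "AE x in lborel. f x = h x" by eventually_elim simp
    ultimately show "l2_rel f h" by (simp add: l2_rel_def)
  qed
qed

instantiation l2 :: (euclidean_space) real_vector
begin

lift_definition zero_l2 :: "'a l2" is "\<lambda>_. 0"
  by (simp add: l2_rel_def square_integrable_zero)
lift_definition plus_l2 :: "'a l2 \<Rightarrow> 'a l2 \<Rightarrow> 'a l2" is "\<lambda>f g x. f x + g x"
  by (auto simp: l2_rel_def square_integrable_add)
lift_definition minus_l2 :: "'a l2 \<Rightarrow> 'a l2 \<Rightarrow> 'a l2" is "\<lambda>f g x. f x - g x"
  by (auto simp: l2_rel_def square_integrable_diff)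
lift_definition uminus_l2 :: "'a l2 \<Rightarrow> 'a l2" is "\<lambda>f x. - f x"
  by (auto simp: l2_rel_def square_integrable_uminus)
lift_definition scaleR_l2 :: "real \<Rightarrow> 'a l2 \<Rightarrow> 'a l2" is "\<lambda>a f x. a * f x"
  by (auto simp: l2_rel_def square_integrable_scale)

instance
proof
  fix a b :: real and f g h :: "'a l2"
  note rels = l2_rel_def square_integrable_add square_integrable_diff square_integrable_zero
    square_integrable_uminus square_integrable_scale algebra_simps
  show "f + g + h = f + (g + h)" by transfer (auto simp: rels)
  show "f + g = g + f" by transfer (auto simp: rels)
  show "0 + f = f" by transfer (auto simp: rels)
  show "- f + f = 0" by transfer (auto simp: rels)
  show "f - g = f + - g" by transfer (auto simp: rels)
  show "a *\<^sub>R (f + g) = a *\<^sub>R f + a *\<^sub>R g"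
    by transfer (simp add: l2_rel_def square_integrable_add square_integrable_scale distrib_left)
  show "(a + b) *\<^sub>R f = a *\<^sub>R f + b *\<^sub>R f"
    by transfer (simp add: l2_rel_def square_integrable_add square_integrable_scale distrib_right)
  show "a *\<^sub>R b *\<^sub>R f = (a * b) *\<^sub>R f"
    by transfer (simp add: l2_rel_def square_integrable_scale mult.assoc)
  show "1 *\<^sub>R f = f" by transfer (auto simp: rels)
qed

end

instantiation l2 :: (euclidean_space) real_inner
begin

lift_definition inner_l2 :: "'a l2 \<Rightarrow> 'a l2 \<Rightarrow> real" is "\<lambda>f g. \<integral>x. f x * g x \<partial>lborel"
  by (rule integral_cong_AE) (auto simp: l2_rel_def square_integrable_def)
definition norm_l2 :: "'a l2 \<Rightarrow> real" where "norm_l2 f = sqrt (f \<bullet> f)"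
definition sgn_l2 :: "'a l2 \<Rightarrow> 'a l2" where "sgn_l2 f = f /\<^sub>R norm f"
definition dist_l2 :: "'a l2 \<Rightarrow> 'a l2 \<Rightarrow> real" where "dist_l2 f g = norm (f - g)"
definition uniformity_l2 :: "('a l2 \<times> 'a l2) filter"
  where "uniformity_l2 = (INF e\<in>{0 <..}. principal {(x, y). dist x y < e})"
definition open_l2 :: "'a l2 set \<Rightarrow> bool"
  where "open_l2 S = (\<forall>x\<in>S. \<forall>\<^sub>F (x', y) in uniformity. x' = x \<longrightarrow> y \<in> S)"

instance
proof
  fix a :: real and f g h :: "'a l2"
  show "f \<bullet> g = g \<bullet> f" by transfer (simp add: mult.commute)
  show "(f + g) \<bullet> h = f \<bullet> h + g \<bullet> h"
    by transfer (simp add: l2_rel_def square_integrable_mult distrib_right)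
  show "(a *\<^sub>R f) \<bullet> g = a * (f \<bullet> g)"
    by transfer (simp add: mult.assoc)
  show "0 \<le> f \<bullet> f"
    by transfer simp
  show "f \<bullet> f = 0 \<longleftrightarrow> f = 0"
  proof transfer
    fix f :: "'a \<Rightarrow> real" assume "l2_rel f f"
    then have f: "square_integrable f" by (simp add: l2_rel_def)
    show "(\<integral>x. f x * f x \<partial>lborel) = 0 \<longleftrightarrow> l2_rel f (\<lambda>_. 0)"
      using integral_nonneg_eq_0_iff_AE[OF square_integrable_mult[OF f f]] f
      by (simp add: l2_rel_def square_integrable_zero)
  qed
qed (rule norm_l2_def sgn_l2_def dist_l2_def uniformity_l2_def open_l2_def)+

end

lemma l2_rep:
  obtains f where "square_integrable f" "l2_rel f f" "u = abs_l2 f"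
  by (metis Quotient_l2 Quotient_abs_rep Quotient_rep_reflp l2_rel_def)

lemma nn_integral_square_abs_l2:
  assumes "square_integrable f" "square_integrable g"
  shows "(\<integral>\<^sup>+x. ennreal ((f x - g x)\<^sup>2) \<partial>lborel) = ennreal ((dist (abs_l2 f) (abs_l2 g))\<^sup>2)"
proof -
  note d = square_integrable_diff[OF assms]
  have "abs_l2 f - abs_l2 g = abs_l2 (\<lambda>x. f x - g x)"
    using assms by (intro minus_l2.abs_eq) (simp_all add: l2_rel_def)
  then have "(dist (abs_l2 f) (abs_l2 g))\<^sup>2 = (\<integral>x. (f x - g x)\<^sup>2 \<partial>lborel)"
    using d by (simp add: dist_norm power2_norm_eq_inner inner_l2.abs_eq l2_rel_def
        flip: power2_eq_square)
  moreover have "(\<integral>\<^sup>+x. ennreal ((f x - g x)\<^sup>2) \<partial>lborel)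
      = ennreal (\<integral>x. (f x - g x)\<^sup>2 \<partial>lborel)"
    using d by (intro nn_integral_eq_integral) (auto simp: square_integrable_def)
  ultimately show ?thesis by simp
qed

instance l2 :: (euclidean_space) banach
proof
  fix X :: "nat \<Rightarrow> 'a l2"
  assume X: "Cauchy X"
  have "\<forall>n. \<exists>N. \<forall>i\<ge>N. \<forall>j\<ge>N. dist (X i) (X j) < (1/4::real)^n"
    using X by (auto simp: Cauchy_def)
  then obtain N where N: "\<And>n i j. N n \<le> i \<Longrightarrow> N n \<le> j \<Longrightarrow> dist (X i) (X j) < (1/4)^n"
    by metis
  define r where "r n = n + (\<Sum>i\<le>n. N i)" for n
  have r: "strict_mono r"
    by (rule strict_mono_Suc_iff[THEN iffD2]) (simp add: r_def)
  have rN: "N n \<le> r n" for n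
    using member_le_sum[of n "{..n}" N] unfolding r_def by simp
  have d: "dist (X (r m)) (X (r n)) < (1/4)^n" if "n \<le> m" for m n
  proof (rule N)
    show "N n \<le> r n" by (rule rN)
    also have "r n \<le> r m" using r that by (simp add: strict_mono_less_eq)
    finally show "N n \<le> r m" .
  qed
  have "\<forall>n. \<exists>f. square_integrable f \<and> X (r n) = abs_l2 f"
    by (metis l2_rep)
  then obtain u where u: "\<And>n. square_integrable (u n)" and Xu: "\<And>n. X (r n) = abs_l2 (u n)"
    by metis
  have um [measurable]: "u n \<in> borel_measurable lborel" for n
    using u[of n] by (simp add: square_integrable_def)
  have D: "(\<integral>\<^sup>+x. ennreal ((u m x - u n x)\<^sup>2) \<partial>lborel) \<le> ennreal ((1/16)^n)"
    if "n \<le> m" for m n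
  proof -
    have "(dist (X (r m)) (X (r n)))\<^sup>2 \<le> ((1/4)^n)\<^sup>2"
      using d[OF that] by (intro power_mono) auto
    also have "\<dots> = (1/16::real)^n"
      by (simp add: power2_eq_square flip: power_mult_distrib)
    finally show ?thesis
      by (simp add: nn_integral_square_abs_l2 u Xu ennreal_leI)
  qed
  define s where "s n x = 4^n * (u (Suc n) x - u n x)\<^sup>2" for n x
  have sm [measurable]: "s n \<in> borel_measurable lborel" for n
    unfolding s_def by measurable
  have "(\<integral>\<^sup>+x. (\<Sum>n. ennreal (s n x)) \<partial>lborel) = (\<Sum>n. \<integral>\<^sup>+x. ennreal (s n x) \<partial>lborel)"
    by (rule nn_integral_suminf) measurable
  also have "\<dots> \<le> (\<Sum>n. ennreal ((1/4)^n))"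
  proof (intro suminf_le allI)
    fix n
    have "(\<integral>\<^sup>+x. ennreal (s n x) \<partial>lborel)
        = ennreal (4^n) * (\<integral>\<^sup>+x. ennreal ((u (Suc n) x - u n x)\<^sup>2) \<partial>lborel)"
      by (simp add: s_def ennreal_mult nn_integral_cmult)
    also have "\<dots> \<le> ennreal (4^n) * ennreal ((1/16)^n)"
      by (intro mult_left_mono D) auto
    also have "\<dots> = ennreal ((1/4)^n)"
      by (simp flip: ennreal_mult power_mult_distrib)
    finally show "(\<integral>\<^sup>+x. ennreal (s n x) \<partial>lborel) \<le> ennreal ((1/4)^n)" .
  qed auto
  also have "\<dots> < \<infinity>"
    by (subst suminf_ennreal2) (auto intro: summable_geometric)
  finally have "AE x in lborel. (\<Sum>n. ennreal (s n x)) \<noteq> \<infinity>"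
    by (intro nn_integral_noteq_infinite) auto
  then have conv: "AE x in lborel. convergent (\<lambda>n. u n x)"
  proof eventually_elim
    case (elim x)
    have "summable (\<lambda>n. s n x)"
      using elim by (intro summable_suminf_not_top) (auto simp: s_def)
    then have "(\<lambda>n. s n x) \<longlonglongrightarrow> 0" by (rule summable_LIMSEQ_zero)
    then have "Bseq (\<lambda>n. s n x)" by (intro convergent_imp_Bseq convergentI)
    then obtain K where K: "\<And>n. \<bar>s n x\<bar> \<le> K" by (auto simp: Bseq_def)
    have "\<bar>u (Suc n) x - u n x\<bar> \<le> sqrt K * (1/2)^n" for n
    proof -
      have "(2^n * \<bar>u (Suc n) x - u n x\<bar>)\<^sup>2 = \<bar>s n x\<bar>"
        by (simp add: s_def power_mult_distrib abs_mult power2_eq_square[of "2^n"]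
            flip: power_mult_distrib[of 2 2])
      then have "2^n * \<bar>u (Suc n) x - u n x\<bar> \<le> sqrt K"
        using K[of n] by (intro real_le_rsqrt) simp
      then show ?thesis by (simp add: field_simps)
    qed
    moreover have "summable (\<lambda>n. sqrt K * (1/2)^n)"
      by (rule summable_mult, rule summable_geometric) simp
    ultimately have "summable (\<lambda>n. u (Suc n) x - u n x)"
      by (metis (no_types, lifting) real_norm_def summable_comparison_test')
    then have "convergent (\<lambda>n. \<Sum>i<n. u (Suc i) x - u i x)"
      by (simp add: summable_iff_convergent)
    then have "convergent (\<lambda>n. u n x - u 0 x)"
      by (simp only: sum_lessThan_telescope[of "\<lambda>n. u n x"])
    then have "convergent (\<lambda>n. (u n x - u 0 x) + u 0 x)"
      by (intro convergent_add convergent_const)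
    then show ?case by simp
  qed
  define g where "g x = lim (\<lambda>n. u n x)" for x
  have gm [measurable]: "g \<in> borel_measurable lborel"
    unfolding g_def by (rule borel_measurable_lim_metric) measurable
  have lim: "AE x in lborel. (\<lambda>n. u n x) \<longlonglongrightarrow> g x"
    using conv by eventually_elim (simp add: g_def convergent_LIMSEQ_iff)
  have G: "(\<integral>\<^sup>+x. ennreal ((g x - u n x)\<^sup>2) \<partial>lborel) \<le> ennreal ((1/16)^n)" for n
  proof -
    have "(\<integral>\<^sup>+x. ennreal ((g x - u n x)\<^sup>2) \<partial>lborel)
        = (\<integral>\<^sup>+x. liminf (\<lambda>m. ennreal ((u m x - u n x)\<^sup>2)) \<partial>lborel)"
    proof (rule nn_integral_cong_AE)
      show "AE x in lborel. ennreal ((g x - u n x)\<^sup>2)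
          = liminf (\<lambda>m. ennreal ((u m x - u n x)\<^sup>2))"
        using lim
      proof eventually_elim
        case (elim x)
        then have "(\<lambda>m. ennreal ((u m x - u n x)\<^sup>2)) \<longlonglongrightarrow> ennreal ((g x - u n x)\<^sup>2)"
          by (intro tendsto_intros tendsto_ennrealI)
        then show ?case by (intro lim_imp_Liminf[symmetric]) auto
      qed
    qed
    also have "\<dots> \<le> liminf (\<lambda>m. \<integral>\<^sup>+x. ennreal ((u m x - u n x)\<^sup>2) \<partial>lborel)"
      by (rule nn_integral_liminf) measurable
    also have "\<dots> \<le> limsup (\<lambda>m. \<integral>\<^sup>+x. ennreal ((u m x - u n x)\<^sup>2) \<partial>lborel)"
      by (rule Liminf_le_Limsup) simp
    also have "\<dots> \<le> ennreal ((1/16)^n)"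
      using D by (intro Limsup_bounded) (auto simp: eventually_sequentially)
    finally show ?thesis .
  qed
  have "square_integrable (\<lambda>x. g x - u 0 x)"
    unfolding square_integrable_def
  proof
    show "integrable lborel (\<lambda>x. (g x - u 0 x)\<^sup>2)"
      using G[of 0] by (intro integrableI_bounded) (auto simp: le_less_trans)
  qed measurable
  from square_integrable_add[OF this u[of 0]] have g: "square_integrable g" by simp
  have "(\<lambda>n. X (r n)) \<longlonglongrightarrow> abs_l2 g"
  proof (rule metric_LIMSEQ_I)
    fix e :: real assume e: "0 < e"
    obtain k where k: "(1/4::real)^k < e"
      using real_arch_pow_inv[OF e, of "1/4"] by auto
    have "dist (X (r n)) (abs_l2 g) < e" if "k \<le> n" for n
    proof -
      have "(dist (abs_l2 g) (X (r n)))\<^sup>2 \<le> (1/16)^n"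
        using G[of n] by (simp add: nn_integral_square_abs_l2 u g Xu)
      also have "\<dots> = ((1/4::real)^n)\<^sup>2"
        by (simp add: power2_eq_square flip: power_mult_distrib)
      finally have "dist (abs_l2 g) (X (r n)) \<le> (1/4)^n"
        by (rule power2_le_imp_le) simp
      also have "\<dots> \<le> (1/4)^k" using that by (intro power_decreasing) auto
      finally show ?thesis using k by (simp add: dist_commute)
    qed
    then show "\<exists>no. \<forall>n\<ge>no. dist (X (r n)) (abs_l2 g) < e" by auto
  qed
  then have "X \<longlonglongrightarrow> abs_l2 g"
    using Cauchy_converges_subseq[OF X r] by (simp add: o_def)
  then show "convergent X" by (auto simp: convergent_def)
qed

text \<open>
  The identification of a Hilbert space with its dual (Riesz) is the library map
  \<open>blinfun_inner_right\<close>; it is bijective and isometric.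
\<close>

lemma riesz_representation:
  fixes \<phi> :: "'x::{real_inner,banach} \<Rightarrow>\<^sub>L real"
  shows "\<exists>w. \<phi> = blinfun_inner_right w"
proof -
  define J where "J x = (norm x)\<^sup>2 - 2 * blinfun_apply \<phi> x" for x
  have J_ge: "- (norm \<phi>)\<^sup>2 \<le> J x" for x
  proof -
    have "blinfun_apply \<phi> x \<le> norm \<phi> * norm x"
      using norm_blinfun[of \<phi> x] by simp
    moreover have "norm x * norm \<phi> = norm \<phi> * norm x" by simp
    ultimately show ?thesis
      using zero_le_power2[of "norm x - norm \<phi>"]
      unfolding J_def power2_diff by linarith
  qed
  define I where "I = (INF x. J x)"
  have bdd: "bdd_below (range J)" by (rule bdd_belowI2[OF J_ge])
  have I_le: "I \<le> J x" for x unfolding I_def by (rule cINF_lower[OF bdd]) simp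
  have "\<exists>x. J x < I + inverse (real (Suc k))" for k
    using cINF_less_iff[OF _ bdd, of "I + inverse (real (Suc k))"] by (auto simp: I_def)
  then obtain x where x: "\<And>k. J (x k) < I + inverse (real (Suc k))" by metis
  have par: "(norm (a - b))\<^sup>2 = 2 * J a + 2 * J b - 4 * J ((1/2) *\<^sub>R (a + b))" for a b
    by (simp add: J_def power2_norm_eq_inner blinfun.add_right blinfun.scaleR_right
        algebra_simps inner_commute)
  have "Cauchy x"
  proof (rule metric_CauchyI)
    fix e :: real assume "0 < e"
    then have "0 < e\<^sup>2 / 4" by simp
    then obtain M where M: "inverse (real (Suc M)) < e\<^sup>2 / 4" using reals_Archimedean by blast
    have "dist (x i) (x j) < e" if "M \<le> i" "M \<le> j" for i j
    proof -
      have "inverse (real (Suc i)) \<le> inverse (real (Suc M))"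
        "inverse (real (Suc j)) \<le> inverse (real (Suc M))"
        using that by (auto intro!: le_imp_inverse_le)
      then have "(norm (x i - x j))\<^sup>2 < e\<^sup>2"
        using par[of "x i" "x j"] x[of i] x[of j] I_le[of "(1/2) *\<^sub>R (x i + x j)"] M by linarith
      then show ?thesis
        using \<open>0 < e\<close> by (auto simp: dist_norm intro: power2_less_imp_less)
    qed
    then show "\<exists>M. \<forall>m\<ge>M. \<forall>n\<ge>M. dist (x m) (x n) < e" by blast
  qed
  then obtain w where w: "x \<longlonglongrightarrow> w" using Cauchy_convergent convergent_def by blast
  have "(\<lambda>k. J (x k)) \<longlonglongrightarrow> J w"
    unfolding J_def by (intro tendsto_intros w)
  moreover have "(\<lambda>k. I + inverse (real (Suc k))) \<longlonglongrightarrow> I + 0"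
    by (intro tendsto_intros LIMSEQ_inverse_real_of_nat)
  ultimately have "J w \<le> I + 0"
    by (rule LIMSEQ_le) (use x less_imp_le in blast)
  then have Jw: "J w \<le> I" by simp
  have "blinfun_apply \<phi> z = w \<bullet> z" for z
  proof (cases "z = 0")
    case False
    define c where "c = w \<bullet> z - blinfun_apply \<phi> z"
    define t where "t = - c / (z \<bullet> z)"
    have zz: "z \<bullet> z > 0" using False by simp
    have "0 \<le> J (w + t *\<^sub>R z) - J w" using I_le[of "w + t *\<^sub>R z"] Jw by simp
    also have "\<dots> = 2 * t * c + t\<^sup>2 * (z \<bullet> z)"
      unfolding J_def c_def power2_norm_eq_inner
      by (simp add: blinfun.add_right blinfun.scaleR_right algebra_simps inner_commute
          power2_eq_square[of t])
    also have "\<dots> = - (c\<^sup>2 / (z \<bullet> z))"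
      using zz by (simp add: t_def power2_eq_square field_simps)
    finally have "c\<^sup>2 / (z \<bullet> z) \<le> 0" by simp
    then have "c = 0" using zz by (simp add: divide_le_0_iff)
    then show ?thesis by (simp add: c_def)
  qed (simp add: blinfun.zero_right)
  then show ?thesis by (intro exI[of _ w] blinfun_eqI) simp
qed

lemma bij_blinfun_inner_right:
  "bij (blinfun_inner_right :: 'x::{real_inner,banach} \<Rightarrow> 'x \<Rightarrow>\<^sub>L real)"
proof (rule bijI)
  show "inj (blinfun_inner_right :: 'x \<Rightarrow> 'x \<Rightarrow>\<^sub>L real)"
    by (rule injI) (metis blinfun_inner_right.rep_eq vector_eq_rdot inner_commute)
  show "surj (blinfun_inner_right :: 'x \<Rightarrow> 'x \<Rightarrow>\<^sub>L real)"
    using riesz_representation by (metis surjI)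
qed

lemma norm_blinfun_inner_right: "norm (blinfun_inner_right w) = norm w"
proof (rule antisym)
  show "norm (blinfun_inner_right w) \<le> norm w"
    by (rule norm_blinfun_bound) (simp_all add: Cauchy_Schwarz_ineq2)
  have "w \<bullet> w \<le> norm (blinfun_inner_right w) * norm w"
    using norm_blinfun[of "blinfun_inner_right w" w] by simp
  then have "norm w * norm w \<le> norm (blinfun_inner_right w) * norm w"
    by (simp add: dot_square_norm power2_eq_square)
  then show "norm w \<le> norm (blinfun_inner_right w)"
    by (cases "w = 0") auto
qed


section \<open>Dual pairs generated by an injective linear operator\<close>

text \<open>
  Throughout, \<open>L :: 'x \<Rightarrow> 'v\<close> plays the role of the operator called \<open>L*\<close> in the literature: it is
  linear and injective from the Banach space \<open>'x\<close> into a real vector space \<open>'v\<close> of generalized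
  functions.  The predual \<open>B\<close> is \<open>range L\<close>, with norm transported along \<open>L\<close>.  An element of
  the dual \<open>B'\<close> is a functional on \<open>range L\<close>; it is represented by its extension by \<open>0\<close> to
  \<open>'v\<close>, so that equality of functionals is equality of functions.
\<close>

definition predual_norm :: "('x::real_normed_vector \<Rightarrow> 'v::real_vector) \<Rightarrow> 'v \<Rightarrow> real" where
  "predual_norm L b = norm (inv L b)"

definition dual :: "('x::real_normed_vector \<Rightarrow> 'v::real_vector) \<Rightarrow> ('v \<Rightarrow> real) set" where
  "dual L = {f.
     (\<forall>b\<in>range L. \<forall>b'\<in>range L. f (b + b') = f b + f b') \<and>
     (\<forall>c. \<forall>b\<in>range L. f (c *\<^sub>R b) = c * f b) \<and>
     (\<exists>C. \<forall>b\<in>range L. \<bar>f b\<bar> \<le> C * predual_norm L b) \<and>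
     (\<forall>b. b \<notin> range L \<longrightarrow> f b = 0)}"

definition adjoint_op ::
    "('x::real_normed_vector \<Rightarrow> 'v::real_vector) \<Rightarrow> ('v \<Rightarrow> real) \<Rightarrow> ('x \<Rightarrow>\<^sub>L real)" where
  "adjoint_op L f = Blinfun (\<lambda>x. f (L x))"

definition inv_adjoint_op ::
    "('x::real_normed_vector \<Rightarrow> 'v::real_vector) \<Rightarrow> ('x \<Rightarrow>\<^sub>L real) \<Rightarrow> ('v \<Rightarrow> real)" where
  "inv_adjoint_op L = inv_into (dual L) (adjoint_op L)"

definition weak_star ::
    "('x::real_normed_vector \<Rightarrow> 'v::real_vector) \<Rightarrow> ('v \<Rightarrow> real) topology" where
  "weak_star L =
     pullback_topology (dual L) (\<lambda>f. restrict f (range L)) (powertop_real (range L))"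

lemma adjoint_op_apply:
  assumes "linear L" "inj L" "f \<in> dual L"
  shows "blinfun_apply (adjoint_op L f) x = f (L x)"
proof -
  from assms(3) obtain C where C: "\<And>b. b \<in> range L \<Longrightarrow> \<bar>f b\<bar> \<le> C * predual_norm L b"
    unfolding dual_def by blast
  have "bounded_linear (\<lambda>x. f (L x))"
  proof (rule bounded_linear_intro)
    fix x y c
    show "f (L (x + y)) = f (L x) + f (L y)" "f (L (c *\<^sub>R x)) = c *\<^sub>R f (L x)"
      using assms(3) by (auto simp: dual_def linear_add[OF assms(1)] linear_scale[OF assms(1)])
    show "norm (f (L x)) \<le> norm x * C"
      using C[of "L x"] by (simp add: predual_norm_def assms(2) mult.commute)
  qed
  then show ?thesis by (simp add: adjoint_op_def bounded_linear_Blinfun_apply)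
qed

lemma extension_in_dual:
  assumes "linear L" "inj L"
  shows "(\<lambda>b. if b \<in> range L then blinfun_apply \<mu> (inv L b) else 0) \<in> dual L"
proof -
  have add: "inv L (L x + L y) = x + y" and scale: "inv L (c *\<^sub>R L x) = c *\<^sub>R x" for x y c
    by (metis assms inv_f_f linear_add, metis assms inv_f_f linear_scale)
  have "L x + L y \<in> range L" "c *\<^sub>R L x \<in> range L" for x y c
    by (metis assms(1) linear_add rangeI, metis assms(1) linear_scale rangeI)
  then show ?thesis
    using norm_blinfun[of \<mu>] assms(2)
    by (auto simp: dual_def predual_norm_def add scale blinfun.add_right blinfun.scaleR_right)
qed

lemma bij_betw_adjoint_op:
  assumes "linear L" "inj L"
  shows "bij_betw (adjoint_op L) (dual L) UNIV"
  unfolding bij_betw_def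
proof
  show "inj_on (adjoint_op L) (dual L)"
  proof (rule inj_onI, rule ext)
    fix f g b assume fg: "f \<in> dual L" "g \<in> dual L" "adjoint_op L f = adjoint_op L g"
    show "f b = g b"
    proof (cases "b \<in> range L")
      case True
      then show ?thesis using adjoint_op_apply[OF assms] fg by (metis rangeE)
    qed (use fg in \<open>simp add: dual_def\<close>)
  qed
  have "\<mu> \<in> adjoint_op L ` dual L" for \<mu>
    by (rule image_eqI[OF _ extension_in_dual[OF assms, of \<mu>]], rule blinfun_eqI)
      (simp add: adjoint_op_apply[OF assms extension_in_dual[OF assms]] assms(2))
  then show "adjoint_op L ` dual L = UNIV" by blast
qed

lemma inv_adjoint_op_apply:
  assumes "linear L" "inj L"
  shows "inv_adjoint_op L \<mu> = (\<lambda>b. if b \<in> range L then blinfun_apply \<mu> (inv L b) else 0)"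
    (is "_ = ?g")
proof -
  have "adjoint_op L ?g = \<mu>"
    by (rule blinfun_eqI)
      (simp add: adjoint_op_apply[OF assms extension_in_dual[OF assms]] assms(2))
  moreover have "inv_into (dual L) (adjoint_op L) (adjoint_op L ?g) = ?g"
    by (rule inv_into_f_f[OF bij_betw_imp_inj_on[OF bij_betw_adjoint_op[OF assms]]
          extension_in_dual[OF assms]])
  ultimately show ?thesis
    by (simp only: inv_adjoint_op_def)
qed


section \<open>The two-component inverse problem\<close>

text \<open>
  For \<open>L\<close> defined on the self-dual space \<open>l2\<close>, the adjoint and its inverse are composed with the
  Riesz identification, so that they map between the dual space and \<open>l2\<close> itself.
\<close>

definition adjoint_op_l2 ::
    "('a::euclidean_space l2 \<Rightarrow> 'v::real_vector) \<Rightarrow> ('v \<Rightarrow> real) \<Rightarrow> 'a l2" where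
  "adjoint_op_l2 L f = inv blinfun_inner_right (adjoint_op L f)"

definition inv_adjoint_op_l2 ::
    "('a::euclidean_space l2 \<Rightarrow> 'v::real_vector) \<Rightarrow> 'a l2 \<Rightarrow> ('v \<Rightarrow> real)" where
  "inv_adjoint_op_l2 L w = inv_adjoint_op L (blinfun_inner_right w)"

definition green ::
    "('a::euclidean_space c0 \<Rightarrow> 'v::real_vector) \<Rightarrow> 'a \<Rightarrow> ('v \<Rightarrow> real)" where
  "green L \<tau> = inv_adjoint_op L (dirac \<tau>)"

definition riesz_map ::
    "('a::euclidean_space l2 \<Rightarrow> 'v::real_vector) \<Rightarrow> 'v \<Rightarrow> ('v \<Rightarrow> real)" where
  "riesz_map L b = inv_adjoint_op_l2 L (inv L b)"

text \<open>
  A candidate \<open>f = f1 + f2\<close> is kept as the pair of its components.  Each measurement functional lies in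
  both preduals, so it acts on the sum through the two duality pairings.
\<close>

definition measure_op :: "('m::finite \<Rightarrow> 'v) \<Rightarrow> ('v \<Rightarrow> real) \<times> ('v \<Rightarrow> real) \<Rightarrow> real ^ 'm" where
  "measure_op \<nu> = (\<lambda>(f1, f2). \<chi> m. f1 (\<nu> m) + f2 (\<nu> m))"

definition strictly_convex :: "('x::real_vector \<Rightarrow> real) \<Rightarrow> bool" where
  "strictly_convex F \<longleftrightarrow> (\<forall>u v t. u \<noteq> v \<and> 0 < t \<and> t < 1 \<longrightarrow>
     F (t *\<^sub>R u + (1 - t) *\<^sub>R v) < t * F u + (1 - t) * F v)"

definition objective ::
    "('a::euclidean_space c0 \<Rightarrow> 'v::real_vector) \<Rightarrow> ('a l2 \<Rightarrow> 'v) \<Rightarrow> ('m::finite \<Rightarrow> 'v) \<Rightarrow>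
     (real ^ 'm \<Rightarrow> real ^ 'm \<Rightarrow> real) \<Rightarrow> real \<Rightarrow> real \<Rightarrow> real ^ 'm \<Rightarrow>
     ('v \<Rightarrow> real) \<times> ('v \<Rightarrow> real) \<Rightarrow> real" where
  "objective L1 L2 \<nu> E lam1 lam2 y = (\<lambda>(f1, f2).
     E y (measure_op \<nu> (f1, f2)) + lam1 * (norm (adjoint_op L1 f1))\<^sup>2
       + lam2 * (norm (adjoint_op_l2 L2 f2))\<^sup>2)"

definition solution_set ::
    "('a::euclidean_space c0 \<Rightarrow> 'v::real_vector) \<Rightarrow> ('a l2 \<Rightarrow> 'v) \<Rightarrow> ('m::finite \<Rightarrow> 'v) \<Rightarrow>
     (real ^ 'm \<Rightarrow> real ^ 'm \<Rightarrow> real) \<Rightarrow> real \<Rightarrow> real \<Rightarrow> real ^ 'm \<Rightarrow>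
     (('v \<Rightarrow> real) \<times> ('v \<Rightarrow> real)) set" where
  "solution_set L1 L2 \<nu> E lam1 lam2 y =
     {f. is_arg_min (objective L1 L2 \<nu> E lam1 lam2 y) (\<lambda>f. f \<in> dual L1 \<times> dual L2) f}"

text \<open>
  Function types are not an instance of \<open>real_vector\<close>, so \<open>extreme_point_of\<close> does not apply
  to sets of functionals.
\<close>

definition extremal_point :: "('v \<Rightarrow> real) set \<Rightarrow> ('v \<Rightarrow> real) \<Rightarrow> bool" where
  "extremal_point C f \<longleftrightarrow> f \<in> C \<and>
     (\<forall>f1\<in>C. \<forall>f2\<in>C. \<forall>t. 0 < t \<and> t < 1 \<and> f = (\<lambda>b. t * f1 b + (1 - t) * f2 b) \<longrightarrow>
       f = f1 \<and> f = f2)"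

end

theory Submission
  imports Defs
begin

text \<open>
  Transporting everything along the two isometries turns a candidate into a pair of a Radon measure
  \<open>\<mu>\<close> and a square-integrable \<open>w\<close>, and the problem into minimizing
  \<open>E y (moments of \<mu> + moments of w) + \<lambda>1 * \<parallel>\<mu>\<parallel>\<^sup>2 + \<lambda>2 * \<parallel>w\<parallel>\<^sup>2\<close>, where the moments are the finitely
  many numbers obtained by pairing with \<open>x m = inv L1s (\<nu> m)\<close> and \<open>z m = inv L2s (\<nu> m)\<close>.

  Existence.  By Banach-Alaoglu (\<open>compactin_weak_star_ball\<close>) the moment vectors of a dual ball form a
  compact subset of a Euclidean space, so the search for a minimizer is a search for the minimum of a
  continuous function on a compact set in finite dimension (\<open>cost_minimizer_exists\<close>).

  Shape of the solution set.  The midpoint of two minimizers would cost strictly less if they had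
  different second components or different total moments, by the parallelogram law and the strict
  convexity of \<open>E y\<close> (\<open>cost_minimizers_agree\<close>).  Hence \<open>S = V \<times> {f02}\<close>, where \<open>V\<close> corresponds to the
  measures with prescribed moments and least possible norm; \<open>V\<close> is a weak*-closed part of a ball, so it
  is compact.  The common \<open>w\<close> is orthogonal to every direction invisible to the moments, hence a
  combination of the \<open>z m\<close>.

  Extremal points.  Let \<open>\<mu>\<close> be an extreme point of the measures of least norm with given moments, and
  \<open>g\<close> a function in \<open>c0\<close> with \<open>\<parallel>g\<parallel> \<le> 1\<close> such that \<open>g \<mu>\<close> has zero moments.  Since \<open>1 + g\<close> and \<open>1 - g\<close>
  are nonnegative, \<open>\<parallel>(1 + g) \<mu>\<parallel> + \<parallel>(1 - g) \<mu>\<parallel> \<le> 2 * \<parallel>\<mu>\<parallel>\<close>; by minimality both summands equal \<open>\<parallel>\<mu>\<parallel>\<close>, and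
  extremality forces \<open>g \<mu> = 0\<close>.  So the map from \<open>g\<close> to the moments of \<open>g \<mu>\<close>, whose target has
  dimension \<open>CARD('m)\<close>, has the annihilator of \<open>\<mu>\<close> as its kernel.  The support of \<open>\<mu>\<close>, defined as the
  zero set of this ideal, therefore has at most \<open>CARD('m)\<close> points: interpolation functions at more points
  would have a nontrivial combination in the annihilator, yet that combination is nonzero at one of
  the points.  A measure with finite support is a combination of Dirac measures.  The argument
  manipulates functionals on \<open>c0\<close> only and avoids representing them by set functions.
\<close>

section \<open>Dual spaces and weak* compactness\<close>

lemma inv_adjoint_op_in_dual:
  assumes "linear L" "inj L"
  shows "inv_adjoint_op L \<mu> \<in> dual L"
  using extension_in_dual[OF assms] by (simp add: inv_adjoint_op_apply[OF assms])

lemma inv_adjoint_op_on_range: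
  assumes "linear L" "inj L"
  shows "inv_adjoint_op L \<mu> (L x) = \<mu> x"
  using assms(2) by (simp add: inv_adjoint_op_apply[OF assms])

lemma adjoint_inv_adjoint_op:
  assumes "linear L" "inj L"
  shows "adjoint_op L (inv_adjoint_op L \<mu>) = \<mu>"
  using bij_betw_imp_surj_on[OF bij_betw_adjoint_op[OF assms]]
  by (simp add: inv_adjoint_op_def f_inv_into_f)

lemma inv_adjoint_adjoint_op:
  assumes "linear L" "inj L" "f \<in> dual L"
  shows "inv_adjoint_op L (adjoint_op L f) = f"
  using bij_betw_imp_inj_on[OF bij_betw_adjoint_op[OF assms(1,2)]] assms(3)
  by (simp add: inv_adjoint_op_def)

lemma topspace_weak_star [simp]: "topspace (weak_star L) = dual L"
  by (auto simp: weak_star_def topspace_pullback_topology)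

lemma continuous_map_weak_star_eval:
  assumes "b \<in> range L"
  shows "continuous_map (weak_star L) euclideanreal (\<lambda>f. f b)"
proof -
  have "continuous_map (weak_star L) euclideanreal ((\<lambda>\<phi>. \<phi> b) \<circ> (\<lambda>f. restrict f (range L)))"
    unfolding weak_star_def
    by (rule continuous_map_pullback) (use assms in \<open>rule continuous_map_product_coordinates\<close>)
  then show ?thesis using assms by (simp add: o_def)
qed

text \<open>
  Every open set of the pullback topology is a preimage, so a cover of \<open>S\<close> comes from a cover of \<open>f ` S\<close>.
\<close>

lemma compactin_pullback_topology:
  assumes S: "S \<subseteq> A" and fS: "compactin T (f ` S)"
  shows "compactin (pullback_topology A f T) S"
  unfolding compactin_def
proof (intro conjI allI impI)
  show "S \<subseteq> topspace (pullback_topology A f T)"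
    using S compactin_subset_topspace[OF fS] by (auto simp: topspace_pullback_topology)
  fix \<U> assume U: "Ball \<U> (openin (pullback_topology A f T)) \<and> S \<subseteq> \<Union>\<U>"
  then have "\<forall>U\<in>\<U>. \<exists>V. openin T V \<and> U = f -` V \<inter> A"
    by (simp add: openin_pullback_topology)
  then obtain V where V: "\<And>U. U \<in> \<U> \<Longrightarrow> openin T (V U)" "\<And>U. U \<in> \<U> \<Longrightarrow> U = f -` V U \<inter> A"
    by metis
  have "f ` S \<subseteq> \<Union>(V ` \<U>)" using U V(2) by fastforce
  then obtain \<F> where F: "finite \<F>" "\<F> \<subseteq> V ` \<U>" "f ` S \<subseteq> \<Union>\<F>"
    using fS V(1) unfolding compactin_def by (metis (no_types, lifting) imageE)
  obtain \<G> where G: "\<G> \<subseteq> \<U>" "finite \<G>" "\<F> = V ` \<G>"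
    using finite_subset_image[OF F(1,2)] by blast
  have "S \<subseteq> \<Union>\<G>"
  proof
    fix s assume "s \<in> S"
    then obtain U where "U \<in> \<G>" "f s \<in> V U" using F(3) G(3) by blast
    then show "s \<in> \<Union>\<G>" using V(2)[of U] G(1) S \<open>s \<in> S\<close> by blast
  qed
  then show "\<exists>\<F>. finite \<F> \<and> \<F> \<subseteq> \<U> \<and> S \<subseteq> \<Union>\<F>" using G by blast
qed

text \<open>
  Banach-Alaoglu.  Restricted to \<open>range L\<close>, the functionals of norm at most \<open>r\<close> are exactly the
  elements of a product of compact intervals that satisfy the pointwise equations of linearity.  The
  product is compact by Tychonoff's theorem, and each equation is a closed condition.
\<close>

theorem compactin_weak_star_ball:
  assumes L: "linear L" "inj L" and r: "0 \<le> r"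
  shows "compactin (weak_star L) {f \<in> dual L. norm (adjoint_op L f) \<le> r}" (is "compactin _ ?B")
proof -
  let ?R = "range L" and ?T = "powertop_real (range L)"
  let ?P = "PiE ?R (\<lambda>b. {- (r * predual_norm L b)..r * predual_norm L b})"
  define A where "A b b' = {\<phi> \<in> topspace ?T. \<phi> (b + b') - (\<phi> b + \<phi> b') \<in> {0}}" for b b'
  define H where "H c b = {\<phi> \<in> topspace ?T. \<phi> (c *\<^sub>R b) - c * \<phi> b \<in> {0}}" for c b
  have add_range: "b + b' \<in> ?R" if "b \<in> ?R" "b' \<in> ?R" for b b'
    using that by (auto simp flip: linear_add[OF L(1)])
  have scale_range: "c *\<^sub>R b \<in> ?R" if "b \<in> ?R" for b c
    using that by (auto simp flip: linear_scale[OF L(1)])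
  have coord: "continuous_map ?T euclideanreal (\<lambda>\<phi>. \<phi> b)" if "b \<in> ?R" for b
    using that by (rule continuous_map_product_coordinates)
  have A: "closedin ?T (A b b')" if "b \<in> ?R" "b' \<in> ?R" for b b'
    unfolding A_def
    by (intro closedin_continuous_map_preimage[where Y=euclideanreal] continuous_map_diff continuous_map_add coord
        that add_range) simp
  have H: "closedin ?T (H c b)" if "b \<in> ?R" for b c
    unfolding H_def
    by (intro closedin_continuous_map_preimage[where Y=euclideanreal] continuous_map_diff
        continuous_map_real_mult_left coord that scale_range) simp
  let ?K = "?P \<inter> (\<Inter>b\<in>?R. \<Inter>b'\<in>?R. A b b') \<inter> (\<Inter>c. \<Inter>b\<in>?R. H c b)"
  have "compactin ?T ?P" by (simp add: compactin_PiE)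
  moreover have "closedin ?T (\<Inter>b\<in>?R. \<Inter>b'\<in>?R. A b b')"
    using A by (intro closedin_INT) auto
  moreover have "closedin ?T (\<Inter>c. \<Inter>b\<in>?R. H c b)"
    using H by (intro closedin_INT) auto
  ultimately have K: "compactin ?T ?K"
    by (intro compact_Int_closedin)
  have "(\<lambda>f. restrict f ?R) ` ?B = ?K"
  proof (intro equalityI subsetI)
    fix \<phi> assume "\<phi> \<in> (\<lambda>f. restrict f ?R) ` ?B"
    then obtain f where f: "f \<in> dual L" "norm (adjoint_op L f) \<le> r" "\<phi> = restrict f ?R" by blast
    have bd: "\<bar>f (L x)\<bar> \<le> r * norm x" for x
      using norm_blinfun[of "adjoint_op L f" x] f(2) mult_right_mono[OF f(2), of "norm x"]
      by (simp add: adjoint_op_apply[OF L f(1)])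
    then have "\<phi> \<in> ?P"
      using L(2) by (auto simp: f(3) predual_norm_def abs_le_iff minus_le_iff)
    moreover have "\<phi> \<in> A b b'" if "b \<in> ?R" "b' \<in> ?R" for b b'
    proof -
      have "f (b + b') = f b + f b'" using f(1) that unfolding dual_def by blast
      then show ?thesis using that add_range[OF that] by (simp add: A_def f(3))
    qed
    moreover have "\<phi> \<in> H c b" if "b \<in> ?R" for b c
    proof -
      have "f (c *\<^sub>R b) = c * f b" using f(1) that unfolding dual_def by blast
      then show ?thesis using that scale_range[OF that] by (simp add: H_def f(3))
    qed
    ultimately show "\<phi> \<in> ?K" by blast
  next
    fix \<phi> assume \<phi>: "\<phi> \<in> ?K"
    define f where "f b = (if b \<in> ?R then \<phi> b else 0)" for b
    have bd: "\<bar>\<phi> b\<bar> \<le> r * predual_norm L b" if "b \<in> ?R" for b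
    proof -
      have "\<phi> b \<in> {- (r * predual_norm L b)..r * predual_norm L b}"
        using \<phi> that by (auto simp: PiE_iff)
      then show ?thesis by auto
    qed
    have f: "f \<in> dual L"
      unfolding dual_def
    proof (intro CollectI conjI ballI allI impI)
      show "f (b + b') = f b + f b'" if "b \<in> ?R" "b' \<in> ?R" for b b'
      proof -
        have "\<phi> \<in> A b b'" using \<phi> that by blast
        then show ?thesis using that add_range[OF that] by (simp add: f_def A_def)
      qed
      show "f (c *\<^sub>R b) = c * f b" if "b \<in> ?R" for c b
      proof -
        have "\<phi> \<in> H c b" using \<phi> that by blast
        then show ?thesis using that scale_range[OF that] by (simp add: f_def H_def)
      qed
      show "\<exists>C. \<forall>b\<in>?R. \<bar>f b\<bar> \<le> C * predual_norm L b"
        using bd by (auto simp: f_def)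
    qed (simp add: f_def)
    have "norm (adjoint_op L f) \<le> r"
      using bd[OF rangeI] r L(2)
      by (intro norm_blinfun_bound) (auto simp: adjoint_op_apply[OF L f] f_def predual_norm_def)
    moreover have "\<phi> = restrict f ?R"
      using \<phi> by (auto simp: f_def fun_eq_iff PiE_iff extensional_def)
    ultimately show "\<phi> \<in> (\<lambda>f. restrict f ?R) ` ?B" using f by blast
  qed
  then show ?thesis
    unfolding weak_star_def by (intro compactin_pullback_topology) (use K in auto)
qed

section \<open>Finitely many moments and the regularized cost\<close>

definition moments :: "('m::finite \<Rightarrow> 'x::real_normed_vector) \<Rightarrow> ('x \<Rightarrow>\<^sub>L real) \<Rightarrow> real ^ 'm" where
  "moments x \<mu> = (\<chi> m. blinfun_apply \<mu> (x m))"

lemma moments_add: "moments x (\<mu> + \<rho>) = moments x \<mu> + moments x \<rho>"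
  and moments_diff: "moments x (\<mu> - \<rho>) = moments x \<mu> - moments x \<rho>"
  and moments_scaleR: "moments x (c *\<^sub>R \<mu>) = c *\<^sub>R moments x \<mu>"
  by (simp_all add: moments_def vec_eq_iff blinfun.add_left blinfun.diff_left blinfun.scaleR_left)

text \<open>
  The moment map is weak*-continuous, so this is Banach-Alaoglu with the identity as operator: then
  \<open>dual\<close> is the ordinary dual space, with functionals as plain functions.
\<close>

lemma compact_moments_ball:
  fixes x :: "'m::finite \<Rightarrow> 'x::real_normed_vector"
  assumes "0 \<le> r"
  shows "compact (moments x ` {\<mu>. norm \<mu> \<le> r})"
proof -
  let ?L = "\<lambda>v :: 'x. v"
  let ?ev = "\<lambda>f :: 'x \<Rightarrow> real. \<chi> m. f (x m)"
  have L: "linear ?L" "inj ?L" by (simp_all add: linear_id[unfolded id_def])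
  have "continuous_map (weak_star ?L) euclidean ?ev"
    unfolding continuous_map_atin limitin_canonical_iff
  proof (intro ballI tendsto_vec_lambda)
    fix f m assume "f \<in> topspace (weak_star ?L)"
    then show "((\<lambda>f. f (x m)) \<longlongrightarrow> f (x m)) (atin (weak_star ?L) f)"
      using continuous_map_weak_star_eval[of "x m" ?L] by (simp add: continuous_map_atin)
  qed
  then have "compact (?ev ` {f \<in> dual ?L. norm (adjoint_op ?L f) \<le> r})"
    unfolding compactin_euclidean_iff[symmetric]
    by (rule image_compactin[OF compactin_weak_star_ball[OF L assms]])
  also have "?ev ` {f \<in> dual ?L. norm (adjoint_op ?L f) \<le> r} = moments x ` {\<mu>. norm \<mu> \<le> r}"
  proof (intro equalityI subsetI)
    fix v assume "v \<in> ?ev ` {f \<in> dual ?L. norm (adjoint_op ?L f) \<le> r}"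
    then obtain f where f: "f \<in> dual ?L" "norm (adjoint_op ?L f) \<le> r" "v = ?ev f" by blast
    then have "v = moments x (adjoint_op ?L f)"
      by (simp add: moments_def adjoint_op_apply[OF L f(1)])
    then show "v \<in> moments x ` {\<mu>. norm \<mu> \<le> r}" using f(2) by blast
  next
    fix v assume "v \<in> moments x ` {\<mu>. norm \<mu> \<le> r}"
    then obtain \<mu> where \<mu>: "norm \<mu> \<le> r" "v = moments x \<mu>" by blast
    then have "v = ?ev (inv_adjoint_op ?L \<mu>)"
      by (simp add: moments_def inv_adjoint_op_on_range[OF L])
    then show "v \<in> ?ev ` {f \<in> dual ?L. norm (adjoint_op ?L f) \<le> r}"
      using \<mu>(1) inv_adjoint_op_in_dual[OF L] adjoint_inv_adjoint_op[OF L] by auto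
  qed
  finally show ?thesis .
qed

text \<open>
  The objective after transport along the isometries, with the fixed data vector absorbed into \<open>G\<close>.
\<close>

definition cost ::
    "(real ^ 'm \<Rightarrow> real) \<Rightarrow> real \<Rightarrow> real \<Rightarrow> ('m::finite \<Rightarrow> 'x::real_normed_vector) \<Rightarrow> ('m \<Rightarrow> 'h::real_inner) \<Rightarrow>
     ('x \<Rightarrow>\<^sub>L real) \<Rightarrow> 'h \<Rightarrow> real" where
  "cost G \<alpha> \<beta> x z \<mu> w =
     G (moments x \<mu> + moments z (blinfun_inner_right w)) + \<alpha> * (norm \<mu>)\<^sup>2 + \<beta> * (norm w)\<^sup>2"

lemma blinfun_inner_right_scaleR: "blinfun_inner_right (c *\<^sub>R w) = c *\<^sub>R blinfun_inner_right w"
  and blinfun_inner_right_add: "blinfun_inner_right (w + u) = blinfun_inner_right w + blinfun_inner_right u"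
  by (auto intro!: blinfun_eqI simp: blinfun.scaleR_left blinfun.add_left inner_add_left)

text \<open>
  A pair enters the cost only through its two norms and its moments.  Writing \<open>\<mu>\<close> as \<open>a\<close> times a vector of
  the unit ball, and likewise \<open>w\<close>, leads to a continuous function \<open>F\<close> of two radii and two moment vectors,
  which range over a compact set once the radii are bounded by some \<open>R\<close>.  Outside that bound the
  regularization terms already exceed the cost \<open>G 0\<close> of the zero pair.  A minimizer of \<open>F\<close> may
  have a radius larger than the norm it stands for, but this only lowers the cost.
\<close>

lemma cost_minimizer_exists:
  fixes x :: "'m::finite \<Rightarrow> 'x::real_normed_vector" and z :: "'m \<Rightarrow> 'h::{real_inner, banach}"
  assumes G: "continuous_on UNIV G" "\<And>v. 0 \<le> G v" and pos: "0 < \<alpha>" "0 < \<beta>"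
  obtains \<mu> w where "\<And>\<rho> u. cost G \<alpha> \<beta> x z \<mu> w \<le> cost G \<alpha> \<beta> x z \<rho> u"
proof -
  \<comment> \<open>With this radius, exceeding R in either norm costs at least the value at zero.\<close>
  define R where "R = sqrt (G 0 / \<alpha>) + sqrt (G 0 / \<beta>)"
  have R0: "0 \<le> R" using G(2)[of 0] pos by (simp add: R_def)
  have R\<alpha>: "G 0 \<le> \<alpha> * R\<^sup>2"
  proof -
    have "(sqrt (G 0 / \<alpha>))\<^sup>2 \<le> R\<^sup>2"
      using G(2)[of 0] pos by (intro power_mono) (simp_all add: R_def)
    then show ?thesis using G(2)[of 0] pos by (simp add: field_simps)
  qed
  have R\<beta>: "G 0 \<le> \<beta> * R\<^sup>2"
  proof -
    have "(sqrt (G 0 / \<beta>))\<^sup>2 \<le> R\<^sup>2"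
      using G(2)[of 0] pos by (intro power_mono) (simp_all add: R_def)
    then show ?thesis using G(2)[of 0] pos by (simp add: field_simps)
  qed
  define B where "B = moments x ` {\<mu>. norm \<mu> \<le> 1}"
  define D where "D = moments z ` {\<mu>. norm \<mu> \<le> 1}"
  define F where "F = (\<lambda>(a, p, b, q). G (a *\<^sub>R p + b *\<^sub>R q) + \<alpha> * a\<^sup>2 + \<beta> * b\<^sup>2)"
  have "continuous_on ({0..R} \<times> B \<times> {0..R} \<times> D) F"
    unfolding F_def case_prod_beta
    by (intro continuous_intros continuous_on_compose2[OF G(1)]) auto
  moreover have "compact ({0..R} \<times> B \<times> {0..R} \<times> D)"
    unfolding B_def D_def by (intro compact_Times compact_moments_ball) auto
  moreover have "0 \<in> B" "0 \<in> D"
    by (auto simp: B_def D_def moments_def vec_eq_iff blinfun.zero_left intro!: image_eqI[of _ _ 0])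
  then have "(0, 0, 0, 0) \<in> {0..R} \<times> B \<times> {0..R} \<times> D" using R0 by simp
  ultimately obtain k where k: "k \<in> {0..R} \<times> B \<times> {0..R} \<times> D"
    "\<And>l. l \<in> {0..R} \<times> B \<times> {0..R} \<times> D \<Longrightarrow> F k \<le> F l"
    using continuous_attains_inf[of "{0..R} \<times> B \<times> {0..R} \<times> D" F] by blast
  then obtain a \<mu> b \<eta> where abk: "k = (a, moments x \<mu>, b, moments z \<eta>)" "0 \<le> a" "0 \<le> b"
    "norm \<mu> \<le> 1" "norm \<eta> \<le> 1"
    by (auto simp: B_def D_def)
  obtain w where w: "\<eta> = blinfun_inner_right w" using riesz_representation by blast
  have nw: "norm w \<le> 1" using abk(5) by (simp add: w norm_blinfun_inner_right)
  \<comment> \<open>Inequality only, because the vectors chosen in the unit balls may have norm below 1.\<close>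
  have "cost G \<alpha> \<beta> x z (a *\<^sub>R \<mu>) (b *\<^sub>R w) \<le> F k"
  proof -
    have "norm (a *\<^sub>R \<mu>) \<le> a" "norm (b *\<^sub>R w) \<le> b"
      using abk nw by (simp_all add: mult_left_le)
    then have "\<alpha> * (norm (a *\<^sub>R \<mu>))\<^sup>2 \<le> \<alpha> * a\<^sup>2" "\<beta> * (norm (b *\<^sub>R w))\<^sup>2 \<le> \<beta> * b\<^sup>2"
      using pos by (intro mult_left_mono power_mono; simp)+
    then show ?thesis
      unfolding cost_def F_def abk(1) w by (simp only: moments_scaleR blinfun_inner_right_scaleR case_prod_conv add_mono order_refl)
  qed
  moreover have "F k \<le> cost G \<alpha> \<beta> x z \<rho> u" for \<rho> u
  proof (cases "norm \<rho> \<le> R \<and> norm u \<le> R")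
    case True
    let ?p = "moments x (sgn \<rho>)" and ?q = "moments z (blinfun_inner_right (sgn u))"
    have "?p \<in> B" "?q \<in> D"
      by (auto simp: B_def D_def norm_sgn norm_blinfun_inner_right)
    then have "F k \<le> F (norm \<rho>, ?p, norm u, ?q)" using True by (intro k(2)) auto
    also have "\<dots> = cost G \<alpha> \<beta> x z \<rho> u"
    proof -
      have sgn: "norm v *\<^sub>R sgn v = v" for v :: "'z::real_normed_vector"
        by (cases "v = 0") (simp_all add: sgn_div_norm)
      have "norm \<rho> *\<^sub>R ?p = moments x \<rho>"
        by (simp only: sgn moments_scaleR[symmetric])
      moreover have "norm u *\<^sub>R ?q = moments z (blinfun_inner_right u)"
        by (simp only: sgn moments_scaleR[symmetric] blinfun_inner_right_scaleR[symmetric])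
      ultimately show ?thesis by (simp only: F_def cost_def case_prod_conv)
    qed
    finally show ?thesis .
  next
    case False
    have "F k \<le> F (0, 0, 0, 0)" using \<open>(0, 0, 0, 0) \<in> _\<close> by (rule k(2))
    also have "\<dots> = G 0" by (simp add: F_def)
    also have "G 0 \<le> \<alpha> * (norm \<rho>)\<^sup>2 + \<beta> * (norm u)\<^sup>2"
    proof (cases "norm \<rho> \<le> R")
      case True
      then have "\<beta> * R\<^sup>2 \<le> \<beta> * (norm u)\<^sup>2"
        using False R0 pos by (intro mult_left_mono power_mono) auto
      then show ?thesis using R\<beta> pos by (smt (verit) mult_nonneg_nonneg zero_le_power2)
    next
      case False
      then have "\<alpha> * R\<^sup>2 \<le> \<alpha> * (norm \<rho>)\<^sup>2"
        using R0 pos by (intro mult_left_mono power_mono) auto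
      then show ?thesis using R\<alpha> pos by (smt (verit) mult_nonneg_nonneg zero_le_power2)
    qed
    also have "\<dots> \<le> cost G \<alpha> \<beta> x z \<rho> u" unfolding cost_def using G(2) by simp
    finally show ?thesis .
  qed
  ultimately show thesis using that order_trans by blast
qed

text \<open>
  All three terms are convex, so the midpoint \<open>(\<pi>, v)\<close> costs at most the average.  It would cost strictly
  less if the total moments differed (strict convexity of \<open>G\<close>) or if \<open>w \<noteq> u\<close> (parallelogram law).  Once
  these agree, the norms of the first components must agree as well.
\<close>

lemma cost_minimizers_agree:
  fixes x :: "'m::finite \<Rightarrow> 'x::real_normed_vector" and z :: "'m \<Rightarrow> 'h::real_inner"
  assumes G: "strictly_convex G" and pos: "0 < \<alpha>" "0 < \<beta>"
    and min: "\<And>\<pi> v. cost G \<alpha> \<beta> x z \<mu> w \<le> cost G \<alpha> \<beta> x z \<pi> v"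
    and eq: "cost G \<alpha> \<beta> x z \<rho> u = cost G \<alpha> \<beta> x z \<mu> w"
  shows "u = w" and "moments x \<rho> = moments x \<mu>" and "norm \<rho> = norm \<mu>"
proof -
  define c where "c \<pi> v = moments x \<pi> + moments z (blinfun_inner_right v)" for \<pi> v
  define \<pi> where "\<pi> = (1/2) *\<^sub>R (\<mu> + \<rho>)"
  define v where "v = (1/2) *\<^sub>R (w + u)"
  have c: "c \<pi> v = (1/2) *\<^sub>R c \<mu> w + (1 - 1/2) *\<^sub>R c \<rho> u"
    by (simp add: c_def \<pi>_def v_def moments_add moments_scaleR blinfun_inner_right_scaleR
        blinfun_inner_right_add algebra_simps)
  have G_le: "G (c \<pi> v) \<le> G (c \<mu> w) / 2 + G (c \<rho> u) / 2"
    and G_less: "c \<mu> w \<noteq> c \<rho> u \<Longrightarrow> G (c \<pi> v) < G (c \<mu> w) / 2 + G (c \<rho> u) / 2"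
  proof -
    show less: "G (c \<pi> v) < G (c \<mu> w) / 2 + G (c \<rho> u) / 2" if "c \<mu> w \<noteq> c \<rho> u"
      using G[unfolded strictly_convex_def, rule_format, of "c \<mu> w" "c \<rho> u" "1/2"] that
      by (simp add: c)
    show "G (c \<pi> v) \<le> G (c \<mu> w) / 2 + G (c \<rho> u) / 2"
    proof (cases "c \<mu> w = c \<rho> u")
      case True
      then have "c \<pi> v = c \<mu> w" unfolding c by (simp flip: scaleR_left_distrib)
      then show ?thesis using True by simp
    qed (use less in simp)
  qed
  have "norm \<pi> \<le> (norm \<mu> + norm \<rho>) / 2"
    using norm_triangle_ineq[of \<mu> \<rho>] by (simp add: \<pi>_def)
  then have "(norm \<pi>)\<^sup>2 \<le> ((norm \<mu> + norm \<rho>) / 2)\<^sup>2" by (intro power_mono) auto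
  also have "\<dots> \<le> (norm \<mu>)\<^sup>2 / 2 + (norm \<rho>)\<^sup>2 / 2"
    using zero_le_power2[of "norm \<mu> - norm \<rho>"] by (simp add: power2_eq_square field_simps)
  finally have n1: "\<alpha> * (norm \<pi>)\<^sup>2 \<le> \<alpha> * (norm \<mu>)\<^sup>2 / 2 + \<alpha> * (norm \<rho>)\<^sup>2 / 2"
    using pos(1) mult_left_mono[of _ _ \<alpha>] by (fastforce simp: distrib_left)
  have nv: "(norm v)\<^sup>2 = (norm w)\<^sup>2 / 2 + (norm u)\<^sup>2 / 2 - (norm (u - w))\<^sup>2 / 4"
    by (simp add: v_def power2_norm_eq_inner inner_add_left inner_add_right inner_diff_left
        inner_diff_right inner_commute field_simps)
  have n2: "\<beta> * (norm v)\<^sup>2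
      = \<beta> * (norm w)\<^sup>2 / 2 + \<beta> * (norm u)\<^sup>2 / 2 - \<beta> * (norm (u - w))\<^sup>2 / 4"
    unfolding nv by (simp add: algebra_simps)
  have cost: "cost G \<alpha> \<beta> x z \<pi>' v' = G (c \<pi>' v') + \<alpha> * (norm \<pi>')\<^sup>2 + \<beta> * (norm v')\<^sup>2" for \<pi>' v'
    by (simp add: cost_def c_def)
  have "0 \<le> \<beta> * (norm (u - w))\<^sup>2" using pos(2) by simp
  then have "c \<mu> w = c \<rho> u" "\<beta> * (norm (u - w))\<^sup>2 = 0"
    using min[of \<pi> v] eq n1 n2 G_le G_less unfolding cost by argo+
  then show "u = w" using pos(2) by simp
  then show "moments x \<rho> = moments x \<mu>" using \<open>c \<mu> w = c \<rho> u\<close> by (simp add: c_def)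
  have "\<alpha> * (norm \<rho>)\<^sup>2 = \<alpha> * (norm \<mu>)\<^sup>2"
    using eq \<open>c \<mu> w = c \<rho> u\<close> \<open>u = w\<close> unfolding cost by simp
  then show "norm \<rho> = norm \<mu>" using pos(1) by simp
qed

text \<open>
  A functional vanishing on the common kernel of the \<open>z m\<close> factors through the linear map \<open>T\<close> that
  collects their values; the factor is given by its values on the coordinate axes, pulled back along a
  right inverse \<open>g\<close> of \<open>T\<close>.
\<close>

lemma in_span_if_orthogonal_to_kernel:
  fixes z :: "'m::finite \<Rightarrow> 'h::real_inner"
  assumes w: "\<And>q. (\<And>m. q \<bullet> z m = 0) \<Longrightarrow> w \<bullet> q = 0"
  obtains a :: "real ^ 'm" where "w = (\<Sum>m\<in>UNIV. a $ m *\<^sub>R z m)"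
proof -
  define T :: "'h \<Rightarrow> real ^ 'm" where "T u = (\<chi> m. u \<bullet> z m)" for u
  have T: "linear T"
    by (rule linearI) (simp_all add: T_def vec_eq_iff inner_add_left)
  have "span (range T) \<subseteq> T ` span UNIV"
    using linear_subspace_image[OF T subspace_UNIV] by (simp add: span_eq_iff[THEN iffD2])
  then obtain g where g: "linear g" "\<And>v. v \<in> range T \<Longrightarrow> T (g v) = v"
    using linear_surj_right_inverse[OF T, of "range T" UNIV] by (metis span_superset subsetD)
  define a :: "real ^ 'm" where "a = (\<chi> m. w \<bullet> g (axis m 1))"
  let ?s = "\<Sum>m\<in>UNIV. a $ m *\<^sub>R z m"
  have "w \<bullet> u = ?s \<bullet> u" for u
  proof -
    have "T (u - g (T u)) = 0" using g(2)[of "T u"] by (simp add: linear_diff[OF T])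
    then have "w \<bullet> (u - g (T u)) = 0" by (intro w) (simp add: T_def vec_eq_iff)
    then have "w \<bullet> u = w \<bullet> g (T u)" by (simp add: inner_diff_right)
    also have "T u = (\<Sum>m\<in>UNIV. (u \<bullet> z m) *\<^sub>R axis m 1)"
      by (simp add: T_def vec_eq_iff axis_def if_distrib cong: if_cong)
    also have "w \<bullet> g \<dots> = ?s \<bullet> u"
      by (simp add: linear_sum[OF g(1)] linear_scale[OF g(1)] inner_sum_right inner_sum_left a_def
          inner_commute mult.commute)
    finally show ?thesis .
  qed
  then have "w = ?s" using vector_eq_rdot[of w ?s] by blast
  then show thesis by (rule that)
qed

text \<open>
  Moving \<open>w\<close> along a direction \<open>q\<close> orthogonal to all \<open>z m\<close> leaves the moments unchanged, so the
  minimizer \<open>w\<close> has least norm on that line and is orthogonal to \<open>q\<close>.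
\<close>

lemma cost_minimizer_in_span:
  fixes x :: "'m::finite \<Rightarrow> 'x::real_normed_vector" and z :: "'m \<Rightarrow> 'h::real_inner"
  assumes pos: "0 < \<beta>"
    and min: "\<And>\<pi> v. cost G \<alpha> \<beta> x z \<mu> w \<le> cost G \<alpha> \<beta> x z \<pi> v"
  obtains a :: "real ^ 'm" where "w = (\<Sum>m\<in>UNIV. a $ m *\<^sub>R z m)"
proof (rule in_span_if_orthogonal_to_kernel)
  fix q assume q: "\<And>m. q \<bullet> z m = 0"
  show "w \<bullet> q = 0"
  proof (cases "q = 0")
    case False
    \<comment> \<open>The foot of the perpendicular from the origin to the line through w in direction q.\<close>
    define t where "t = - (w \<bullet> q) / (q \<bullet> q)"
    have "moments z (blinfun_inner_right (w + t *\<^sub>R q)) = moments z (blinfun_inner_right w)"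
      by (simp add: moments_def inner_add_left q)
    then have "(norm w)\<^sup>2 \<le> (norm (w + t *\<^sub>R q))\<^sup>2"
      using min[of \<mu> "w + t *\<^sub>R q"] pos by (simp add: cost_def)
    also have "\<dots> = (norm w)\<^sup>2 + 2 * t * (w \<bullet> q) + t\<^sup>2 * (q \<bullet> q)"
      unfolding power2_norm_eq_inner
      by (simp add: inner_add_left inner_add_right inner_commute power2_eq_square algebra_simps)
    also have "\<dots> = (norm w)\<^sup>2 - (w \<bullet> q)\<^sup>2 / (q \<bullet> q)"
      using False by (simp add: t_def power2_eq_square field_simps)
    finally have "(w \<bullet> q)\<^sup>2 / (q \<bullet> q) \<le> 0" by simp
    moreover have "0 < q \<bullet> q" using False by simp
    ultimately show ?thesis by (auto simp: divide_le_0_iff)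
  qed simp
qed (rule that)

lemma strictly_convex_imp_continuous:
  fixes G :: "'b::euclidean_space \<Rightarrow> real"
  assumes "strictly_convex G"
  shows "continuous_on UNIV G"
proof (rule convex_on_continuous[OF open_UNIV])
  show "convex_on UNIV G"
  proof (rule convex_onI)
    fix t :: real and u v :: 'b assume t: "0 < t" "t < 1"
    show "G ((1 - t) *\<^sub>R u + t *\<^sub>R v) \<le> (1 - t) * G u + t * G v"
    proof (cases "u = v")
      case True
      have "(1 - t) *\<^sub>R v + t *\<^sub>R v = v" by (simp flip: scaleR_left_distrib)
      moreover have "(1 - t) * G v + t * G v = G v" by (simp flip: distrib_right)
      ultimately show ?thesis unfolding True by simp
    next
      case False
      then show ?thesis
        using assms[unfolded strictly_convex_def, rule_format, of u v "1 - t"] t by simp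
    qed
  qed simp
qed

section \<open>Measures of least norm with prescribed moments\<close>

lemma bcontfun_mult:
  fixes f g :: "'a::topological_space \<Rightarrow>\<^sub>C real"
  shows "(\<lambda>x. apply_bcontfun f x * apply_bcontfun g x) \<in> bcontfun"
proof (rule bcontfun_normI)
  show "continuous_on UNIV (\<lambda>x. f x * g x)" by (intro continuous_intros) auto
  show "norm (f x * g x) \<le> norm f * norm g" for x
    unfolding norm_mult by (intro mult_mono norm_bounded) auto
qed

lift_definition c0_mult :: "'a::euclidean_space c0 \<Rightarrow> 'a c0 \<Rightarrow> 'a c0"
  is "\<lambda>f g. Bcontfun (\<lambda>x. apply_bcontfun f x * apply_bcontfun g x)"
proof -
  fix f g :: "'a \<Rightarrow>\<^sub>C real"
  assume f: "(apply_bcontfun f \<longlongrightarrow> 0) at_infinity" and g: "(apply_bcontfun g \<longlongrightarrow> 0) at_infinity"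
  show "(apply_bcontfun (Bcontfun (\<lambda>x. f x * g x)) \<longlongrightarrow> 0) at_infinity"
    using tendsto_mult[OF f g] by (simp add: Bcontfun_inverse[OF bcontfun_mult])
qed

lemma apply_c0_mult [simp]: "apply_c0 (c0_mult f g) x = apply_c0 f x * apply_c0 g x"
proof transfer
  fix f g :: "'a \<Rightarrow>\<^sub>C real" and x
  show "Bcontfun (\<lambda>x. f x * g x) x = f x * g x" by (simp add: Bcontfun_inverse[OF bcontfun_mult])
qed

lemma apply_c0_sum: "apply_c0 (sum f A) x = (\<Sum>i\<in>A. apply_c0 (f i) x)"
  by (induction A rule: infinite_finite_induct) auto

lemma norm_c0_le: "(\<And>x. \<bar>apply_c0 f x\<bar> \<le> B) \<Longrightarrow> norm f \<le> B"
  unfolding norm_c0_eq_SUP by (rule cSUP_least) auto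

lemma bounded_linear_c0_mult: "bounded_linear (c0_mult g)"
proof (rule bounded_linear_intro[where K = "norm g"])
  show "norm (c0_mult g f) \<le> norm f * norm g" for f
    by (rule norm_c0_le)
      (simp add: abs_mult mult.commute[of "norm f"] mult_mono abs_apply_c0_le)
qed (auto intro!: c0_eqI simp: algebra_simps)

text \<open>
  The measure with density \<open>g\<close> with respect to \<open>\<mu>\<close>, as a functional.
\<close>

definition c0_density :: "'a::euclidean_space c0 \<Rightarrow> 'a radon \<Rightarrow> 'a radon" where
  "c0_density g \<mu> = \<mu> o\<^sub>L Blinfun (c0_mult g)"

lemma c0_density_apply [simp]: "blinfun_apply (c0_density g \<mu>) f = blinfun_apply \<mu> (c0_mult g f)"
  by (simp add: c0_density_def bounded_linear_Blinfun_apply bounded_linear_c0_mult)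

lemma norm_blinfun_approx:
  fixes \<mu> :: "'x::real_normed_vector \<Rightarrow>\<^sub>L real"
  assumes "0 < e"
  obtains x where "norm x \<le> 1" "norm \<mu> - e < \<mu> x"
proof (cases "norm \<mu> - e < 0")
  case True
  then show thesis using that[of 0] by (simp add: blinfun.zero_right)
next
  case False
  have "\<not> (\<forall>x. norm (\<mu> x) \<le> (norm \<mu> - e) * norm x)"
  proof
    assume "\<forall>x. norm (\<mu> x) \<le> (norm \<mu> - e) * norm x"
    then have "norm \<mu> \<le> norm \<mu> - e" using False by (intro norm_blinfun_bound) auto
    then show False using assms by simp
  qed
  then obtain x where x: "(norm \<mu> - e) * norm x < \<bar>\<mu> x\<bar>" by (auto simp: not_le)
  then have nz: "norm x > 0" by (auto simp: blinfun.zero_right)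
  have *: "norm \<mu> - e < \<bar>\<mu> x\<bar> / norm x" using x nz by (simp add: field_simps)
  show thesis
    by (rule that[of "(sgn (\<mu> x) / norm x) *\<^sub>R x"])
      (use nz * in \<open>auto simp: blinfun.scaleR_right sgn_real_def abs_if split: if_splits\<close>)
qed

text \<open>
  For a measure this says \<open>\<integral>(1 + g) d\<bar>\<mu>\<bar> + \<integral>(1 - g) d\<bar>\<mu>\<bar> = 2 * \<parallel>\<mu>\<parallel>\<close>.  Without the variation measure: test
  functions \<open>f1\<close> and \<open>f2\<close> almost attaining the two norms combine into \<open>(1 + g) * f1 + (1 - g) * f2\<close>, which is
  bounded by \<open>2\<close> because the weights are nonnegative and sum to \<open>2\<close>.
\<close>

lemma norm_c0_density_split:
  assumes g: "norm g \<le> 1"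
  shows "norm (\<mu> + c0_density g \<mu>) + norm (\<mu> - c0_density g \<mu>) \<le> 2 * norm \<mu>"
proof (rule field_le_epsilon)
  fix e :: real assume e: "0 < e"
  obtain f1 where f1: "norm f1 \<le> 1" "norm (\<mu> + c0_density g \<mu>) - e/2 < (\<mu> + c0_density g \<mu>) f1"
    using norm_blinfun_approx[of "e/2" "\<mu> + c0_density g \<mu>"] e by auto
  obtain f2 where f2: "norm f2 \<le> 1" "norm (\<mu> - c0_density g \<mu>) - e/2 < (\<mu> - c0_density g \<mu>) f2"
    using norm_blinfun_approx[of "e/2" "\<mu> - c0_density g \<mu>"] e by auto
  define f where "f = (f1 + c0_mult g f1) + (f2 - c0_mult g f2)"
  have "norm f \<le> 2"
  proof (rule norm_c0_le)
    fix x
    let ?g = "apply_c0 g x" and ?a = "apply_c0 f1 x" and ?b = "apply_c0 f2 x"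
    have "\<bar>?g\<bar> \<le> 1" "\<bar>?a\<bar> \<le> 1" "\<bar>?b\<bar> \<le> 1"
      using abs_apply_c0_le g f1(1) f2(1) order_trans by metis+
    then have bounds: "\<bar>(1 + ?g) * ?a\<bar> \<le> (1 + ?g) * 1" "\<bar>(1 - ?g) * ?b\<bar> \<le> (1 - ?g) * 1"
      unfolding abs_mult using \<open>\<bar>?g\<bar> \<le> 1\<close> by (intro mult_mono; simp)+
    have "apply_c0 f x = (1 + ?g) * ?a + (1 - ?g) * ?b"
      by (simp add: f_def algebra_simps)
    also have "\<bar>\<dots>\<bar> \<le> (1 + ?g) * 1 + (1 - ?g) * 1"
      by (rule order_trans[OF abs_triangle_ineq add_mono[OF bounds]])
    finally show "\<bar>apply_c0 f x\<bar> \<le> 2" by simp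
  qed
  then have "\<mu> f \<le> norm \<mu> * 2"
    using norm_blinfun[of \<mu> f] mult_left_mono[of "norm f" 2 "norm \<mu>"] by simp
  moreover have "\<mu> f = (\<mu> + c0_density g \<mu>) f1 + (\<mu> - c0_density g \<mu>) f2"
    by (simp add: f_def blinfun.add_right blinfun.diff_right blinfun.add_left blinfun.diff_left)
  ultimately show "norm (\<mu> + c0_density g \<mu>) + norm (\<mu> - c0_density g \<mu>) \<le> 2 * norm \<mu> + e"
    using f1(2) f2(2) by linarith
qed

definition annihilator :: "'a::euclidean_space radon \<Rightarrow> 'a c0 set" where
  "annihilator \<mu> = {g. c0_density g \<mu> = 0}"

text \<open>
  The usual support, expressed algebraically: a point lies outside it iff some function that does not
  vanish there annihilates the measure.
\<close>

definition radon_support :: "'a::euclidean_space radon \<Rightarrow> 'a set" where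
  "radon_support \<mu> = {x. \<forall>g\<in>annihilator \<mu>. apply_c0 g x = 0}"

lemma annihilator_iff: "g \<in> annihilator \<mu> \<longleftrightarrow> (\<forall>f. \<mu> (c0_mult g f) = 0)"
proof -
  have "c0_density g \<mu> = 0 \<longleftrightarrow> (\<forall>f. c0_density g \<mu> f = 0)"
    by (metis blinfun_eqI blinfun.zero_left)
  then show ?thesis by (simp add: annihilator_def)
qed

lemma c0_compact_support:
  fixes f :: "'a::euclidean_space \<Rightarrow> real"
  assumes "continuous_on UNIV f" "compact K" "\<And>x. x \<notin> K \<Longrightarrow> f x = 0"
  obtains g where "f = apply_c0 g"
proof -
  obtain b where b: "\<And>x. x \<in> K \<Longrightarrow> norm x \<le> b"
    using compact_imp_bounded[OF assms(2)] unfolding bounded_iff by blast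
  have "(f \<longlongrightarrow> 0) at_infinity"
  proof (rule tendsto_eventually)
    show "\<forall>\<^sub>F x in at_infinity. f x = 0"
      unfolding eventually_at_infinity using assms(3) b
      by (intro exI[of _ "b + 1"]) force
  qed
  then show thesis using c0_cases[OF assms(1)] that by blast
qed

lemma c0_bump:
  fixes a :: "'a::euclidean_space"
  assumes "finite Z"
  obtains g where "apply_c0 g a = 1" "\<And>x. x \<in> Z \<Longrightarrow> x \<noteq> a \<Longrightarrow> apply_c0 g x = 0"
proof -
  obtain d where d: "0 < d" "\<And>x. x \<in> Z \<Longrightarrow> x \<noteq> a \<Longrightarrow> d \<le> dist a x"
    using finite_set_avoid[OF assms, of a] by blast
  have "continuous_on UNIV (\<lambda>x. max 0 (1 - dist a x / d))"
    by (intro continuous_intros) (use d in auto)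
  then obtain g where g: "(\<lambda>x. max 0 (1 - dist a x / d)) = apply_c0 g"
    by (rule c0_compact_support[where K = "cball a d"]) (use d in \<open>auto simp: field_simps\<close>)
  show thesis
    by (rule that[of g]) (use d in \<open>auto simp: fun_cong[OF g, symmetric] field_simps\<close>)
qed

lemma c0_interpolation:
  fixes Z :: "'a::euclidean_space set"
  assumes "finite Z"
  obtains b where "\<And>c x. x \<in> Z \<Longrightarrow> apply_c0 (\<Sum>\<tau>\<in>Z. c \<tau> *\<^sub>R b \<tau>) x = c x"
proof -
  have "\<forall>\<tau>. \<exists>g. apply_c0 g \<tau> = 1 \<and> (\<forall>x\<in>Z. x \<noteq> \<tau> \<longrightarrow> apply_c0 g x = 0)"
    using c0_bump[OF assms] by metis
  then obtain b where b: "\<And>\<tau>. apply_c0 (b \<tau>) \<tau> = 1"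
    "\<And>\<tau> x. x \<in> Z \<Longrightarrow> x \<noteq> \<tau> \<Longrightarrow> apply_c0 (b \<tau>) x = 0"
    by metis
  have "apply_c0 (\<Sum>\<tau>\<in>Z. c \<tau> *\<^sub>R b \<tau>) x = c x" if "x \<in> Z" for c x
  proof -
    have "apply_c0 (\<Sum>\<tau>\<in>Z. c \<tau> *\<^sub>R b \<tau>) x = (\<Sum>\<tau>\<in>Z. if x = \<tau> then c \<tau> else 0)"
      unfolding apply_c0_sum using b that by (intro sum.cong) auto
    then show ?thesis using assms that by simp
  qed
  then show thesis by (rule that)
qed

text \<open>
  The annihilator is an ideal.  Finitely many of its elements have no common zero on the compact set \<open>K\<close>,
  so the sum \<open>G\<close> of their squares lies in it and is bounded below by some \<open>d > 0\<close> on \<open>K\<close>.  Dividing \<open>f\<close> by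
  \<open>G\<close> then shows that \<open>f\<close> is a multiple of \<open>G\<close>.
\<close>

lemma vanishes_off_support:
  fixes \<mu> :: "'a::euclidean_space radon"
  assumes K: "compact K" and KZ: "K \<inter> radon_support \<mu> = {}" and f: "\<And>x. x \<notin> K \<Longrightarrow> apply_c0 f x = 0"
  shows "\<mu> f = 0"
proof -
  have "\<forall>x\<in>K. \<exists>g\<in>annihilator \<mu>. apply_c0 g x \<noteq> 0"
    using KZ by (auto simp: radon_support_def)
  then obtain g where g: "\<And>x. x \<in> K \<Longrightarrow> g x \<in> annihilator \<mu>" "\<And>x. x \<in> K \<Longrightarrow> apply_c0 (g x) x \<noteq> 0"
    by metis
  define U where "U x = {z. apply_c0 (g x) z \<noteq> 0}" for x
  have "open (U x)" for x
    unfolding U_def by (intro open_Collect_neq continuous_on_apply_c0 continuous_intros)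
  moreover have "K \<subseteq> (\<Union>x\<in>K. U x)" using g(2) by (auto simp: U_def)
  ultimately obtain C where C: "C \<subseteq> K" "finite C" "K \<subseteq> (\<Union>x\<in>C. U x)"
    using compactE_image[OF K, of K U] by blast
  define G where "G = (\<Sum>x\<in>C. c0_mult (g x) (g x))"
  have applyG: "apply_c0 G z = (\<Sum>x\<in>C. (apply_c0 (g x) z)\<^sup>2)" for z
  proof -
    show ?thesis by (simp add: G_def apply_c0_sum power2_eq_square)
  qed
  have pos: "0 < apply_c0 G z" if zK: "z \<in> K" for z
  proof -
    obtain x where "x \<in> C" "z \<in> U x" using zK C(3) by blast
    then have "x \<in> C" "apply_c0 (g x) z \<noteq> 0" by (simp_all add: U_def)
    then show ?thesis unfolding applyG using C(2) by (intro sum_pos2[of C x]) auto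
  qed
  obtain d where d: "0 < d" "\<And>z. z \<in> K \<Longrightarrow> d \<le> apply_c0 G z"
  proof (cases "K = {}")
    case True then show thesis using that[of 1] by simp
  next
    case False
    then obtain z where "z \<in> K" "\<forall>w\<in>K. apply_c0 G z \<le> apply_c0 G w"
      using continuous_attains_inf[OF K False continuous_on_apply_c0] by blast
    then show thesis using that[of "apply_c0 G z"] pos by blast
  qed
  \<comment> \<open>The cut-off max keeps the quotient continuous off K, where f is zero and G may vanish.\<close>
  have "continuous_on UNIV (\<lambda>z. apply_c0 f z / max d (apply_c0 G z))"
    by (intro continuous_intros continuous_on_apply_c0) (use d in auto)
  then obtain q where q: "(\<lambda>z. apply_c0 f z / max d (apply_c0 G z)) = apply_c0 q"
    by (rule c0_compact_support[OF _ K]) (simp add: f)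
  have "f = c0_mult G q"
  proof (rule c0_eqI)
    fix z show "apply_c0 f z = apply_c0 (c0_mult G q) z"
      using f[of z] d(2)[of z] d(1) by (cases "z \<in> K") (auto simp: fun_cong[OF q, symmetric] max_def)
  qed
  also have "\<dots> = (\<Sum>x\<in>C. c0_mult (g x) (c0_mult (g x) q))"
  proof (rule c0_eqI)
    fix z
    show "apply_c0 (c0_mult G q) z = apply_c0 (\<Sum>x\<in>C. c0_mult (g x) (c0_mult (g x) q)) z"
      by (simp add: applyG apply_c0_sum sum_distrib_right power2_eq_square mult.assoc)
  qed
  also have "\<mu> \<dots> = (\<Sum>x\<in>C. \<mu> (c0_mult (g x) (c0_mult (g x) q)))"
    by (simp add: blinfun.sum_right)
  also have "\<dots> = 0"
    using g(1) C(1) by (intro sum.neutral) (auto simp: annihilator_iff)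
  finally show ?thesis .
qed

text \<open>
  Shrinking the values of \<open>f\<close> towards zero by \<open>e\<close> changes it by at most \<open>e\<close> in norm and leaves a function
  that is zero off the compact set \<open>{x. e \<le> \<bar>f x\<bar>}\<close>, which misses the support.
\<close>

lemma vanishes_if_zero_on_support:
  fixes \<mu> :: "'a::euclidean_space radon"
  assumes f: "\<And>x. x \<in> radon_support \<mu> \<Longrightarrow> apply_c0 f x = 0"
  shows "\<mu> f = 0"
proof -
  have "\<bar>\<mu> f\<bar> \<le> 0 + e * norm \<mu>" if e: "0 < e" for e :: real
  proof -
    \<comment> \<open>Soft thresholding at level e, written as a sum of continuous positive and negative parts.\<close>
    let ?h = "\<lambda>x. max (apply_c0 f x - e) 0 + min (apply_c0 f x + e) 0"
    let ?K = "{x. e \<le> \<bar>apply_c0 f x\<bar>}"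
    have "\<forall>\<^sub>F x in at_infinity. \<bar>apply_c0 f x\<bar> < e"
      using tendstoD[OF apply_c0_tendsto_0 e, of f] by (simp add: dist_real_def)
    then have "bounded ?K"
      unfolding eventually_at_infinity bounded_iff by (metis linorder_not_less mem_Collect_eq nle_le)
    moreover have "closed ?K"
      by (intro closed_Collect_le continuous_intros continuous_on_apply_c0)
    ultimately have K: "compact ?K" by (simp add: compact_eq_bounded_closed)
    have "continuous_on UNIV ?h" by (intro continuous_intros continuous_on_apply_c0)
    then obtain h where h: "?h = apply_c0 h"
      by (rule c0_compact_support[OF _ K]) auto
    have "\<mu> h = 0"
      by (rule vanishes_off_support[OF K]) (use f e in \<open>auto simp flip: h\<close>)
    moreover have "norm (f - h) \<le> e"
      by (rule norm_c0_le) (use e in \<open>auto simp: fun_cong[OF h, symmetric]\<close>)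
    ultimately have "\<bar>\<mu> f\<bar> = \<bar>\<mu> (f - h)\<bar>" by (simp add: blinfun.diff_right)
    also have "\<dots> \<le> norm \<mu> * norm (f - h)" using norm_blinfun[of \<mu> "f - h"] by simp
    also have "\<dots> \<le> e * norm \<mu>"
      using mult_right_mono[OF \<open>norm (f - h) \<le> e\<close>, of "norm \<mu>"] by (simp add: mult.commute)
    finally show ?thesis by simp
  qed
  note bound = this
  have "\<bar>\<mu> f\<bar> \<le> 0 + e" if e: "0 < e" for e :: real
  proof -
    have "\<bar>\<mu> f\<bar> \<le> e / (norm \<mu> + 1) * norm \<mu>"
      using bound[of "e / (norm \<mu> + 1)"] e by (simp add: add_nonneg_pos)
    also have "\<dots> \<le> e" using e by (simp add: divide_le_eq add_nonneg_pos mult_left_mono)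
    finally show ?thesis by simp
  qed
  then have "\<bar>\<mu> f\<bar> \<le> 0" by (rule field_le_epsilon)
  then show ?thesis by simp
qed

text \<open>
  On a finite support \<open>f\<close> agrees with its interpolant, and \<open>\<mu>\<close> cannot tell the two apart.
\<close>

lemma finite_support_sum_dirac:
  fixes \<mu> :: "'a::euclidean_space radon"
  assumes "finite (radon_support \<mu>)"
  obtains c where "\<mu> = (\<Sum>\<tau>\<in>radon_support \<mu>. c \<tau> *\<^sub>R dirac \<tau>)"
proof -
  obtain b where b: "\<And>c x. x \<in> radon_support \<mu> \<Longrightarrow> apply_c0 (\<Sum>\<tau>\<in>radon_support \<mu>. c \<tau> *\<^sub>R b \<tau>) x = c x"
    using c0_interpolation[OF assms] by blast
  have "\<mu> f = (\<Sum>\<tau>\<in>radon_support \<mu>. \<mu> (b \<tau>) *\<^sub>R dirac \<tau>) f" for f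
  proof -
    let ?p = "\<Sum>\<tau>\<in>radon_support \<mu>. apply_c0 f \<tau> *\<^sub>R b \<tau>"
    have "\<mu> (f - ?p) = 0" by (intro vanishes_if_zero_on_support) (simp add: b)
    then show ?thesis
      by (simp add: blinfun.diff_right blinfun.sum_right blinfun.scaleR_right blinfun.sum_left
          blinfun.scaleR_left dirac.rep_eq mult.commute)
  qed
  then show thesis by (intro that[of "\<lambda>\<tau>. \<mu> (b \<tau>)"] blinfun_eqI)
qed

text \<open>
  An indexed version of the bound on independent sets: it also covers families with repetitions.
\<close>

lemma linear_relation_vec:
  fixes v :: "'i \<Rightarrow> 'b::euclidean_space"
  assumes "finite A" "DIM('b) < card A"
  obtains t where "(\<Sum>i\<in>A. t i *\<^sub>R v i) = 0" "\<exists>i\<in>A. t i \<noteq> 0"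
proof (cases "inj_on v A")
  case True
  have "dependent (v ` A)"
    using assms card_image[OF True] by (intro dependent_biggerset) auto
  then obtain u where u: "(\<Sum>x\<in>v ` A. u x *\<^sub>R x) = 0" "\<exists>x\<in>v ` A. u x \<noteq> 0"
    using assms(1) real_vector.dependent_finite[of "v ` A"] by auto
  then show thesis
    by (intro that[of "u \<circ> v"]) (auto simp: sum.reindex[OF True])
next
  case False
  then obtain i j where ij: "i \<in> A" "j \<in> A" "i \<noteq> j" "v i = v j" by (auto simp: inj_on_def)
  define t where "t k = (if k = i then 1 else if k = j then -1 else (0::real))" for k
  have "(\<Sum>k\<in>A. t k *\<^sub>R v k) = (\<Sum>k\<in>{i, j}. t k *\<^sub>R v k)"
    using ij assms(1) by (intro sum.mono_neutral_right) (auto simp: t_def)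
  also have "\<dots> = 0" using ij by (simp add: t_def)
  finally show thesis using ij by (intro that[of t]) (auto simp: t_def)
qed

text \<open>
  The hypothesis makes \<open>g \<mu>\<close> a function of finitely many numbers.  Of more than \<open>CARD('m)\<close> interpolation
  functions, a nontrivial combination must then lie in the annihilator, although it takes a nonzero
  coefficient as its value at a point of the support.
\<close>

lemma card_support_le:
  fixes \<mu> :: "'a::euclidean_space radon" and x :: "'m::finite \<Rightarrow> 'a c0"
  assumes ann: "\<And>g. (\<And>m. \<mu> (c0_mult g (x m)) = 0) \<Longrightarrow> g \<in> annihilator \<mu>"
  shows "finite (radon_support \<mu>) \<and> card (radon_support \<mu>) \<le> CARD('m)"
proof (rule ccontr)
  assume "\<not> (finite (radon_support \<mu>) \<and> card (radon_support \<mu>) \<le> CARD('m))"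
  then obtain A where A: "A \<subseteq> radon_support \<mu>" "finite A" "card A = Suc CARD('m)"
    by (metis infinite_arbitrarily_large not_less_eq_eq obtain_subset_with_card_n)
  obtain b where b: "\<And>c x. x \<in> A \<Longrightarrow> apply_c0 (\<Sum>\<tau>\<in>A. c \<tau> *\<^sub>R b \<tau>) x = c x"
    using c0_interpolation[OF A(2)] by blast
  obtain t where t: "(\<Sum>\<tau>\<in>A. t \<tau> *\<^sub>R (\<chi> m. \<mu> (c0_mult (b \<tau>) (x m)))) = 0" "\<exists>\<tau>\<in>A. t \<tau> \<noteq> 0"
    using linear_relation_vec[OF A(2), of "\<lambda>\<tau>. \<chi> m. \<mu> (c0_mult (b \<tau>) (x m)) :: real ^ 'm"] A(3) by auto
  let ?g = "\<Sum>\<tau>\<in>A. t \<tau> *\<^sub>R b \<tau>"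
  have "\<mu> (c0_mult ?g (x m)) = 0" for m
  proof -
    have "c0_mult ?g (x m) = (\<Sum>\<tau>\<in>A. t \<tau> *\<^sub>R c0_mult (b \<tau>) (x m))"
      by (rule c0_eqI) (simp add: apply_c0_sum sum_distrib_right mult.assoc)
    then have "\<mu> (c0_mult ?g (x m)) = (\<Sum>\<tau>\<in>A. t \<tau> *\<^sub>R (\<chi> m. \<mu> (c0_mult (b \<tau>) (x m)))) $ m"
      by (simp add: blinfun.sum_right blinfun.scaleR_right)
    then show ?thesis by (simp add: t(1))
  qed
  then have g: "?g \<in> annihilator \<mu>" by (rule ann)
  obtain \<tau> where \<tau>: "\<tau> \<in> A" "t \<tau> \<noteq> 0" using t(2) by blast
  have "apply_c0 ?g \<tau> = t \<tau>" using b[OF \<tau>(1)] .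
  then show False using g \<tau> A(1) by (auto simp: radon_support_def)
qed

text \<open>
  The two hypotheses say that \<open>\<mu>\<close> has least norm among the measures with its moments, and that it is not the
  midpoint of two distinct ones of the same norm.  If \<open>g \<mu>\<close> has zero moments, then, after
  scaling \<open>g\<close> into the unit ball, \<open>\<mu> + g \<mu>\<close> and \<open>\<mu> - g \<mu>\<close> have the moments of \<open>\<mu>\<close>, so each has norm at least
  \<open>\<parallel>\<mu>\<parallel>\<close>, while the sum of their norms is at most \<open>2 * \<parallel>\<mu>\<parallel>\<close>.
\<close>

theorem extreme_min_norm_measure:
  fixes \<mu> :: "'a::euclidean_space radon" and x :: "'m::finite \<Rightarrow> 'a c0"
  assumes min: "\<And>\<rho> :: 'a radon. (\<And>m. blinfun_apply \<rho> (x m) = \<mu> (x m)) \<Longrightarrow> norm \<mu> \<le> norm \<rho>"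
    and ext: "\<And>\<rho> :: 'a radon. (\<And>m. blinfun_apply \<rho> (x m) = 0) \<Longrightarrow> norm (\<mu> + \<rho>) = norm \<mu> \<Longrightarrow> norm (\<mu> - \<rho>) = norm \<mu> \<Longrightarrow> \<rho> = 0"
  obtains T c where "finite T" "card T \<le> CARD('m)" "\<mu> = (\<Sum>\<tau>\<in>T. c \<tau> *\<^sub>R dirac \<tau>)"
proof -
  have "g \<in> annihilator \<mu>" if g: "\<And>m. \<mu> (c0_mult g (x m)) = 0" for g
  proof -
    define s where "s = inverse (norm g + 1)"
    have s: "0 < s" by (simp add: s_def add_nonneg_pos)
    have "norm (s *\<^sub>R g) \<le> 1"
      using norm_ge_zero[of g] s by (simp add: s_def field_simps)
    note split = norm_c0_density_split[OF this, of \<mu>]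
    have sg: "c0_density (s *\<^sub>R g) \<mu> = s *\<^sub>R c0_density g \<mu>"
    proof (rule blinfun_eqI)
      fix f
      have "c0_mult (s *\<^sub>R g) f = s *\<^sub>R c0_mult g f" by (rule c0_eqI) simp
      then show "c0_density (s *\<^sub>R g) \<mu> f = (s *\<^sub>R c0_density g \<mu>) f"
        by (simp add: blinfun.scaleR_right blinfun.scaleR_left)
    qed
    have moments: "c0_density (s *\<^sub>R g) \<mu> (x m) = 0" for m
      by (simp add: sg blinfun.scaleR_left g)
    have "norm \<mu> \<le> norm (\<mu> + c0_density (s *\<^sub>R g) \<mu>)" "norm \<mu> \<le> norm (\<mu> - c0_density (s *\<^sub>R g) \<mu>)"
      using moments by (auto intro!: min simp: blinfun.add_left blinfun.diff_left simp del: c0_density_apply)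
    then have "c0_density (s *\<^sub>R g) \<mu> = 0"
      using split by (intro ext moments) linarith+
    then show ?thesis using s by (simp add: sg annihilator_def)
  qed
  then have "finite (radon_support \<mu>) \<and> card (radon_support \<mu>) \<le> CARD('m)" by (rule card_support_le)
  then show thesis using finite_support_sum_dirac that by metis
qed

section \<open>The two-component inverse problem\<close>

lemma inv_adjoint_op_sum:
  assumes "linear L" "inj L"
  shows "inv_adjoint_op L (\<Sum>i\<in>I. c i *\<^sub>R \<mu> i) = (\<lambda>b. \<Sum>i\<in>I. c i * inv_adjoint_op L (\<mu> i) b)"
  by (auto simp: inv_adjoint_op_apply[OF assms] blinfun.sum_left blinfun.scaleR_left)

lemma blinfun_inner_right_adjoint_op_l2:
  "blinfun_inner_right (adjoint_op_l2 L f) = adjoint_op L f"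
  unfolding adjoint_op_l2_def
  by (rule surj_f_inv_f[OF bij_is_surj[OF bij_blinfun_inner_right]])

lemma adjoint_op_l2_inv:
  assumes "linear L" "inj L"
  shows "adjoint_op_l2 L (inv_adjoint_op_l2 L w) = w"
  unfolding adjoint_op_l2_def inv_adjoint_op_l2_def adjoint_inv_adjoint_op[OF assms]
  by (rule inv_f_f[OF bij_is_inj[OF bij_blinfun_inner_right]])

lemma objective_eq_cost:
  assumes L1: "linear L1" "inj L1" and L2: "linear L2" "inj L2"
    and \<nu>: "\<And>m. \<nu> m = L1 (x m)" "\<And>m. \<nu> m = L2 (z m)"
    and f: "f1 \<in> dual L1" "f2 \<in> dual L2"
  shows "objective L1 L2 \<nu> E \<alpha> \<beta> y (f1, f2)
    = cost (E y) \<alpha> \<beta> x z (adjoint_op L1 f1) (adjoint_op_l2 L2 f2)"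
proof -
  have "f1 (\<nu> m) = adjoint_op L1 f1 (x m)" "f2 (\<nu> m) = adjoint_op L2 f2 (z m)" for m
    by (simp add: \<nu>(1) adjoint_op_apply[OF L1 f(1)], simp add: \<nu>(2) adjoint_op_apply[OF L2 f(2)])
  then have "measure_op \<nu> (f1, f2) = moments x (adjoint_op L1 f1) + moments z (adjoint_op L2 f2)"
    by (simp add: measure_op_def moments_def vec_eq_iff)
  then show ?thesis
    by (simp add: objective_def cost_def blinfun_inner_right_adjoint_op_l2)
qed

text \<open>
  With a minimizing pair \<open>(\<mu>, w)\<close> at hand, the other solutions are the pairs \<open>(\<rho>, w)\<close> in which \<open>\<rho>\<close> has the
  moments of \<open>\<mu>\<close> and no larger norm; no measure with these moments has smaller norm, since it would
  lower the cost.
\<close>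

lemma solution_set_structure:
  fixes L1 :: "'a::euclidean_space c0 \<Rightarrow> 'v::real_vector" and L2 :: "'a l2 \<Rightarrow> 'v"
    and x :: "'m::finite \<Rightarrow> 'a c0"
  assumes L1: "linear L1" "inj L1" and L2: "linear L2" "inj L2"
    and \<nu>: "\<And>m. \<nu> m = L1 (x m)" "\<And>m. \<nu> m = L2 (z m)"
    and E: "\<And>v. 0 \<le> E y v" "strictly_convex (E y)"
    and pos: "0 < \<alpha>" "0 < \<beta>"
  obtains \<mu> a where
    "solution_set L1 L2 \<nu> E \<alpha> \<beta> y =
      {f \<in> dual L1. norm (adjoint_op L1 f) \<le> norm \<mu> \<and> moments x (adjoint_op L1 f) = moments x \<mu>}
        \<times> {inv_adjoint_op_l2 L2 (\<Sum>m\<in>UNIV. a $ m *\<^sub>R z m)}"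
    "\<And>\<rho>. moments x \<rho> = moments x \<mu> \<Longrightarrow> norm \<mu> \<le> norm \<rho>"
proof -
  let ?J = "cost (E y) \<alpha> \<beta> x z"
  obtain \<mu> w where min: "\<And>\<rho> u. ?J \<mu> w \<le> ?J \<rho> u"
    using cost_minimizer_exists[OF strictly_convex_imp_continuous[OF E(2)] E(1) pos] by blast
  obtain a where a: "w = (\<Sum>m\<in>UNIV. a $ m *\<^sub>R z m)"
    using cost_minimizer_in_span[OF pos(2) min] by blast
  note obj = objective_eq_cost[OF L1 L2 \<nu>, where E = E and \<alpha> = \<alpha> and \<beta> = \<beta> and y = y]
  let ?V = "{f \<in> dual L1. norm (adjoint_op L1 f) \<le> norm \<mu> \<and> moments x (adjoint_op L1 f) = moments x \<mu>}"
  let ?g = "inv_adjoint_op_l2 L2 w"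
  have g: "?g \<in> dual L2" "adjoint_op_l2 L2 ?g = w"
    by (simp_all add: adjoint_op_l2_inv[OF L2], simp add: inv_adjoint_op_l2_def inv_adjoint_op_in_dual[OF L2])
  have sol: "(f1, f2) \<in> solution_set L1 L2 \<nu> E \<alpha> \<beta> y \<longleftrightarrow>
    f1 \<in> dual L1 \<and> f2 \<in> dual L2 \<and> ?J (adjoint_op L1 f1) (adjoint_op_l2 L2 f2) = ?J \<mu> w" (is "_ = ?R") for f1 f2
  proof
    assume "(f1, f2) \<in> solution_set L1 L2 \<nu> E \<alpha> \<beta> y"
    then have f: "f1 \<in> dual L1" "f2 \<in> dual L2"
      and le: "\<And>h1 h2. h1 \<in> dual L1 \<Longrightarrow> h2 \<in> dual L2 \<Longrightarrow>
        objective L1 L2 \<nu> E \<alpha> \<beta> y (f1, f2) \<le> objective L1 L2 \<nu> E \<alpha> \<beta> y (h1, h2)"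
      by (auto simp: solution_set_def is_arg_min_linorder)
    have "?J (adjoint_op L1 f1) (adjoint_op_l2 L2 f2) \<le> ?J \<mu> w"
      using le[OF inv_adjoint_op_in_dual[OF L1, of \<mu>] g(1)] f
      by (simp add: obj g inv_adjoint_op_in_dual[OF L1] adjoint_inv_adjoint_op[OF L1])
    then show ?R using f min by (simp add: order_antisym)
  next
    assume ?R
    then show "(f1, f2) \<in> solution_set L1 L2 \<nu> E \<alpha> \<beta> y"
      using min by (auto simp: solution_set_def is_arg_min_linorder obj)
  qed
  have "solution_set L1 L2 \<nu> E \<alpha> \<beta> y = ?V \<times> {?g}"
  proof (intro equalityI subsetI)
    fix f assume f: "f \<in> solution_set L1 L2 \<nu> E \<alpha> \<beta> y"
    obtain f1 f2 where f12: "f = (f1, f2)" by fastforce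
    have R: "f1 \<in> dual L1" "f2 \<in> dual L2" "?J (adjoint_op L1 f1) (adjoint_op_l2 L2 f2) = ?J \<mu> w"
      using f sol by (auto simp: f12)
    note agree = cost_minimizers_agree[OF E(2) pos min R(3)]
    have "f2 = inv_adjoint_op L2 (blinfun_inner_right (adjoint_op_l2 L2 f2))"
      by (simp add: blinfun_inner_right_adjoint_op_l2 inv_adjoint_adjoint_op[OF L2 R(2)])
    then have "f2 = ?g" by (simp add: inv_adjoint_op_l2_def agree(1))
    then show "f \<in> ?V \<times> {?g}" using R(1) agree by (simp add: f12)
  next
    fix f assume "f \<in> ?V \<times> {?g}"
    then obtain f1 where f1: "f = (f1, ?g)" "f1 \<in> ?V" by auto
    have "\<alpha> * (norm (adjoint_op L1 f1))\<^sup>2 \<le> \<alpha> * (norm \<mu>)\<^sup>2"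
      using f1(2) pos by (intro mult_left_mono power_mono) auto
    then have "?J (adjoint_op L1 f1) w \<le> ?J \<mu> w" using f1(2) by (simp add: cost_def)
    then have "?J (adjoint_op L1 f1) w = ?J \<mu> w" using min by (simp add: order_antisym)
    then show "f \<in> solution_set L1 L2 \<nu> E \<alpha> \<beta> y" using f1 by (simp add: sol g)
  qed
  moreover have "norm \<mu> \<le> norm \<rho>" if "moments x \<rho> = moments x \<mu>" for \<rho>
    using min[of \<rho> w] that pos by (simp add: cost_def)
  ultimately show thesis using that a by blast
qed

text \<open>
  Prescribing the moments cuts a weak*-closed set out of a weak*-compact ball.
\<close>

lemma compactin_moment_ball:
  assumes L: "linear L" "inj L" and r: "0 \<le> r"
  shows "compactin (weak_star L) {f \<in> dual L. norm (adjoint_op L f) \<le> r \<and> moments x (adjoint_op L f) = c}"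
proof -
  have "closedin (weak_star L) {f \<in> topspace (weak_star L). f (L (x m)) \<in> {c $ m}}" for m
    by (rule closedin_continuous_map_preimage[OF continuous_map_weak_star_eval]) auto
  then have "closedin (weak_star L) (\<Inter>m. {f \<in> dual L. f (L (x m)) = c $ m})"
    by (intro closedin_INT) auto
  then have "compactin (weak_star L)
      ((\<Inter>m. {f \<in> dual L. f (L (x m)) = c $ m}) \<inter> {f \<in> dual L. norm (adjoint_op L f) \<le> r})"
    by (rule closed_Int_compactin) (rule compactin_weak_star_ball[OF L r])
  also have "(\<Inter>m. {f \<in> dual L. f (L (x m)) = c $ m}) \<inter> {f \<in> dual L. norm (adjoint_op L f) \<le> r}
    = {f \<in> dual L. norm (adjoint_op L f) \<le> r \<and> moments x (adjoint_op L f) = c}"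
    by (auto simp: moments_def vec_eq_iff adjoint_op_apply[OF L])
  finally show ?thesis .
qed

text \<open>
  When \<open>r\<close> is the least norm for the prescribed moments, a perturbation \<open>\<rho>\<close> with zero moments that keeps
  the norm of \<open>\<mu> + \<rho>\<close> and \<open>\<mu> - \<rho>\<close> exhibits \<open>f\<close> as a midpoint inside the set, so extremality applies.
\<close>

lemma extremal_point_sum_green:
  fixes L :: "'a::euclidean_space c0 \<Rightarrow> 'v::real_vector" and x :: "'m::finite \<Rightarrow> 'a c0"
  assumes L: "linear L" "inj L"
    and min: "\<And>\<rho>. moments x \<rho> = c \<Longrightarrow> r \<le> norm \<rho>"
    and extremal: "extremal_point {f \<in> dual L. norm (adjoint_op L f) \<le> r \<and> moments x (adjoint_op L f) = c} f"
      (is "extremal_point ?V f")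
  shows "\<exists>K\<le>CARD('m). \<exists>(c :: nat \<Rightarrow> real) \<tau>. f = (\<lambda>b. \<Sum>k = 1..K. c k * green L (\<tau> k) b)"
proof -
  define \<mu> where "\<mu> = adjoint_op L f"
  have f: "f \<in> dual L" "norm \<mu> \<le> r" "moments x \<mu> = c"
    using extremal by (auto simp: extremal_point_def \<mu>_def)
  have f_eq: "f = inv_adjoint_op L \<mu>" by (simp add: \<mu>_def inv_adjoint_adjoint_op[OF L f(1)])
  have min_norm: "norm \<mu> \<le> norm \<rho>" if "\<And>m. blinfun_apply \<rho> (x m) = \<mu> (x m)" for \<rho>
  proof -
    have "moments x \<rho> = c" using that f(3) by (simp add: moments_def)
    then show ?thesis using min f(2) by fastforce
  qed
  have rigid: "\<rho> = 0"
    if \<rho>: "\<And>m. blinfun_apply \<rho> (x m) = 0" "norm (\<mu> + \<rho>) = norm \<mu>" "norm (\<mu> - \<rho>) = norm \<mu>" for \<rho>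
  proof -
    have \<rho>0: "moments x \<rho> = 0" by (simp add: moments_def vec_eq_iff \<rho>(1))
    have "inv_adjoint_op L (\<mu> + \<rho>) \<in> ?V" "inv_adjoint_op L (\<mu> - \<rho>) \<in> ?V"
      using f(2,3) \<rho>0 \<rho>(2,3)
      by (simp_all add: inv_adjoint_op_in_dual[OF L] adjoint_inv_adjoint_op[OF L] moments_add moments_diff)
    moreover have "f = (\<lambda>b. 1/2 * inv_adjoint_op L (\<mu> + \<rho>) b + (1 - 1/2) * inv_adjoint_op L (\<mu> - \<rho>) b)"
      by (rule ext) (simp add: f_eq inv_adjoint_op_apply[OF L] blinfun.add_left blinfun.diff_left field_simps)
    ultimately have "f = inv_adjoint_op L (\<mu> + \<rho>)"
      using extremal[unfolded extremal_point_def, THEN conjunct2, rule_format, of _ _ "1/2"] by simp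
    from arg_cong[OF this, of "adjoint_op L"] have "\<mu> = \<mu> + \<rho>"
      by (simp add: \<mu>_def adjoint_inv_adjoint_op[OF L])
    then show ?thesis by simp
  qed
  obtain T d where T: "finite T" "card T \<le> CARD('m)" "\<mu> = (\<Sum>\<tau>\<in>T. d \<tau> *\<^sub>R dirac \<tau>)"
    using extreme_min_norm_measure[where \<mu> = \<mu> and x = x, OF min_norm rigid] by blast
  obtain h where h: "bij_betw h {1..card T} T" using ex_bij_betw_nat_finite_1[OF T(1)] by blast
  have "f = (\<lambda>b. \<Sum>\<tau>\<in>T. d \<tau> * green L \<tau> b)"
    unfolding f_eq T(3) inv_adjoint_op_sum[OF L] green_def ..
  also have "\<dots> = (\<lambda>b. \<Sum>k = 1..card T. d (h k) * green L (h k) b)"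
    by (rule ext) (rule sum.reindex_bij_betw[OF h, symmetric])
  finally show ?thesis
    using T(2) by (intro exI[of _ "card T"] conjI exI[of _ "d \<circ> h"] exI[of _ h]) simp_all
qed

theorem corollary2:
  fixes L1s :: "'a::euclidean_space c0 \<Rightarrow> 'v::real_vector"
    and L2s :: "'a l2 \<Rightarrow> 'v"
    and \<nu> :: "'m::finite \<Rightarrow> 'v"
    and E :: "real ^ 'm \<Rightarrow> real ^ 'm \<Rightarrow> real"
    and lam1 lam2 :: real
    and y :: "real ^ 'm"
  assumes "linear L1s" and "inj L1s"
    and "linear L2s" and "inj L2s"
    and "\<And>m. \<nu> m \<in> range L1s \<inter> range L2s"
    and "\<And>u v. 0 \<le> E u v" and "\<And>u. strictly_convex (E u)"
    and "0 < lam1" and "0 < lam2"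
  defines "S \<equiv> solution_set L1s L2s \<nu> E lam1 lam2 y"
  shows "S \<noteq> {} \<and> compactin (prod_topology (weak_star L1s) (weak_star L2s)) S \<and>
    (\<exists>!f02. (\<exists>a :: real ^ 'm. f02 = (\<lambda>b. \<Sum>m\<in>UNIV. a $ m * riesz_map L2s (\<nu> m) b)) \<and>
       (\<forall>f0\<in>S. \<exists>f01\<in>fst ` S. f0 = (f01, f02))) \<and>
    (\<forall>f01. extremal_point (fst ` S) f01 \<longrightarrow>
       (\<exists>K1\<le>CARD('m). \<exists>(c :: nat \<Rightarrow> real) (\<tau> :: nat \<Rightarrow> 'a).
          f01 = (\<lambda>b. \<Sum>k = 1..K1. c k * green L1s (\<tau> k) b)))"
proof -
  note L1 = assms(1,2) and L2 = assms(3,4)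
  define x where "x m = inv L1s (\<nu> m)" for m
  define z where "z m = inv L2s (\<nu> m)" for m
  have \<nu>: "\<nu> m = L1s (x m)" "\<nu> m = L2s (z m)" for m
    using assms(5)[of m] by (simp_all add: x_def z_def f_inv_into_f)
  obtain \<mu> a where S: "S =
      {f \<in> dual L1s. norm (adjoint_op L1s f) \<le> norm \<mu> \<and> moments x (adjoint_op L1s f) = moments x \<mu>}
        \<times> {inv_adjoint_op_l2 L2s (\<Sum>m\<in>UNIV. a $ m *\<^sub>R z m)}" (is "_ = ?V \<times> {?f02}")
    and min: "\<And>\<rho>. moments x \<rho> = moments x \<mu> \<Longrightarrow> norm \<mu> \<le> norm \<rho>"
    by (rule solution_set_structure[OF L1 L2, where \<nu> = \<nu> and E = E and x = x and z = z and y = y,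
          OF \<nu> assms(6,7,8,9), folded S_def]) (rule that)
  define V where "V = ?V"
  define f02 where "f02 = ?f02"
  have S: "S = V \<times> {f02}" unfolding S V_def f02_def ..
  have "inv_adjoint_op L1s \<mu> \<in> V"
    by (simp add: V_def inv_adjoint_op_in_dual[OF L1] adjoint_inv_adjoint_op[OF L1])
  then have ne: "S \<noteq> {}" by (auto simp: S)
  have fstS: "fst ` S = V" by (simp add: S)
  have "compactin (weak_star L1s) V"
    unfolding V_def by (rule compactin_moment_ball[OF L1 norm_ge_zero])
  moreover have "f02 \<in> dual L2s"
    by (simp add: f02_def inv_adjoint_op_l2_def inv_adjoint_op_in_dual[OF L2])
  ultimately have compact: "compactin (prod_topology (weak_star L1s) (weak_star L2s)) S"
    by (simp add: S compactin_Times)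
  have "blinfun_inner_right (\<Sum>m\<in>UNIV. a $ m *\<^sub>R z m) = (\<Sum>m\<in>UNIV. a $ m *\<^sub>R blinfun_inner_right (z m))"
    by (rule blinfun_eqI) (simp add: blinfun.sum_left blinfun.scaleR_left inner_sum_left)
  then have f02: "f02 = (\<lambda>b. \<Sum>m\<in>UNIV. a $ m * riesz_map L2s (\<nu> m) b)"
    by (simp add: f02_def inv_adjoint_op_l2_def riesz_map_def inv_adjoint_op_sum[OF L2] z_def)
  have unique: "\<exists>!f02. (\<exists>a :: real ^ 'm. f02 = (\<lambda>b. \<Sum>m\<in>UNIV. a $ m * riesz_map L2s (\<nu> m) b)) \<and>
       (\<forall>f0\<in>S. \<exists>f01\<in>fst ` S. f0 = (f01, f02))"
  proof (rule ex1I[of _ f02], intro conjI)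
    show "\<exists>a :: real ^ 'm. f02 = (\<lambda>b. \<Sum>m\<in>UNIV. a $ m * riesz_map L2s (\<nu> m) b)"
      by (rule exI[of _ a]) (rule f02)
    show "\<forall>f0\<in>S. \<exists>f01\<in>fst ` S. f0 = (f01, f02)"
      unfolding fstS by (auto simp: S)
  next
    fix g
    assume "(\<exists>a :: real ^ 'm. g = (\<lambda>b. \<Sum>m\<in>UNIV. a $ m * riesz_map L2s (\<nu> m) b)) \<and>
       (\<forall>f0\<in>S. \<exists>f01\<in>fst ` S. f0 = (f01, g))"
    then have g: "\<forall>f0\<in>S. \<exists>f01\<in>fst ` S. f0 = (f01, g)" by (rule conjunct2)
    obtain f01 where "(f01, f02) \<in> S" using ne by (auto simp: S)
    with g have "\<exists>f\<in>fst ` S. (f01, f02) = (f, g)" by (rule bspec)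
    then show "g = f02" by simp
  qed
  have extremal: "\<exists>K1\<le>CARD('m). \<exists>(c :: nat \<Rightarrow> real) (\<tau> :: nat \<Rightarrow> 'a).
      f01 = (\<lambda>b. \<Sum>k = 1..K1. c k * green L1s (\<tau> k) b)" if "extremal_point (fst ` S) f01" for f01
    using extremal_point_sum_green[OF L1 min that[unfolded fstS V_def]] .
  show ?thesis by (intro conjI allI impI ne compact unique extremal)
qed

end
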